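(* Let $p: E\to B$ be a locally trivial fibre bundle with structure group $G$, fibre $X$ and associated principal $G$-bundle $\tau: P\to B$, so that $E=X\times_G P$ and $B=P/G$. Then for every integer $r\ge 2$ the sequential parametrized topological complexity $\mathsf{TC}_r[p: E\to B]$ satisfies $$\mathsf{TC}_{r,G}^w(X;P)\ \le\ \mathsf{TC}_r[p:E\to B]\ \le\ G\text{-}\mathsf{cat}[p:E\to B]\,+\,\mathsf{TC}_{r,G}^w(X;P).$$
   Context: $I=[0,1]$; path spaces carry the compact-open topology. $G$ is a topological group acting on the space $X$; $P$ is the total space of a principal $G$-bundle, $X\times_G P=(X\times P)/G$ is the orbit space of the diagonal action, and $p$ is the map $X\times_G P\to P/G=B$. Sectional category: for a (Hurewicz) fibration $q:E'\to B'$, $\mathsf{secat}[q:E'\to B']$ is the smallest integer $k\ge0$ such that $B'$ has an open cover $U_0,\dots,U_k$ with a continuous section of $q$ over each $U_i$ ($\infty$ if none exists). Generalized sectional category: for a fibration $q:E'\to B'$ and a continuous map $f:B'\to C$, $\mathsf{secat}_f[q:E'\to B']$ is the smallest integer $k\ge 0$ such that there are open sets $U_0,\dots,U_k\subset C$ with $f(B')\subset U_0\cup\dots\cup U_k$ and such that $q$ admits a continuous section over each $f^{-1}(U_i)$ ($\infty$ if none exists). Sequential parametrized topological complexity: for $p:E\to B$ and $r\ge 2$ let $E^r_B=\{(e_1,\dots,e_r)\in E^r: p(e_1)=\dots=p(e_r)\}$, let $E^I_B\subset E^I$ be the space of paths $\gamma:I\to E$ with $p\circ\gamma$ constant, fix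 $0\le t_1<\dots<t_r\le 1$, and let $\Pi_r:E^I_B\to E^r_B$, $\Pi_r(\gamma)=(\gamma(t_1),\dots,\gamma(t_r))$. Then $\mathsf{TC}_r[p:E\to B]=\mathsf{secat}(\Pi_r)$. $G\text{-}\mathsf{cat}[p:E\to B]$ is the smallest integer $k\ge0$ such that $B$ has an open cover $B=U_0\cup\dots\cup U_k$ such that over each $U_i$ the bundle $E$ is trivial as a $G$-bundle; it equals $\mathsf{secat}[\tau:P\to B]$. Weak invariant with coefficients: fix $0=t_1<t_2<\dots<t_r=1$ and let $\rho_r:X^I\to X^r$, $\rho_r(\gamma)=(\gamma(t_1),\dots,\gamma(t_r))$. Let $G$ act diagonally on $X^r$ and on $X^r\times P$, and let $Q:X^r\times P\to X^r\times_G P=(X^r\times P)/G$ be the natural projection. Then $\mathsf{TC}^w_{r,G}(X;P)=\mathsf{secat}_Q[\rho_r\times 1: X^I\times P\to X^r\times P]$.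
   Formalization: The upper bound is stated only for a normal base B (Hausdorff not required), since it fails for arbitrary topological spaces, e.g. for some bundles over the non-normal four-point circle; the lower bound is stated for every B. *)

theory Defs
  imports
    "HOL-Analysis.Analysis"
    "HOL-Algebra.Group_Action"
    "HOL-Library.Extended_Nat"
begin

section \<open>Path spaces and finite powers\<close>

text \<open>
  The unit interval is the real interval \<open>{0..1}\<close>. A path is made unique as a HOL function by
  requiring it to be extensional, i.e. \<open>undefined\<close> off \<open>{0..1}\<close>.
\<close>

definition path_space :: "'a topology \<Rightarrow> (real \<Rightarrow> 'a) topology" where
  "path_space X = topology_generated_by
     {{\<gamma> \<in> extensional {0..1}. pathin X \<gamma> \<and> \<gamma> ` K \<subseteq> U} |K U.
        compactin (subtopology euclideanreal {0..1}) K \<and> openin X U}"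

lemma topspace_path_space:
  "topspace (path_space X) = {\<gamma> \<in> extensional {0..1}. pathin X \<gamma>}"
proof -
  have "topspace (path_space X) = \<Union> {{\<gamma> \<in> extensional {0..1}. pathin X \<gamma> \<and> \<gamma> ` K \<subseteq> U} |K U.
        compactin (subtopology euclideanreal {0..1}) K \<and> openin X U}"
    unfolding path_space_def by (rule topology_generated_by_topspace)
  also have "\<dots> = {\<gamma> \<in> extensional {0..1}. pathin X \<gamma>}"
  proof (intro subset_antisym subsetI)
    fix \<gamma> assume \<gamma>: "\<gamma> \<in> {\<gamma> \<in> extensional {0..1}. pathin X \<gamma>}"
    show "\<gamma> \<in> \<Union> {{\<gamma> \<in> extensional {0..1}. pathin X \<gamma> \<and> \<gamma> ` K \<subseteq> U} |K U.
        compactin (subtopology euclideanreal {0..1}) K \<and> openin X U}"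
    proof (rule UnionI)
      show "{\<gamma> \<in> extensional {0..1}. pathin X \<gamma> \<and> \<gamma> ` {} \<subseteq> {}} \<in>
        {{\<gamma> \<in> extensional {0..1}. pathin X \<gamma> \<and> \<gamma> ` K \<subseteq> U} |K U.
        compactin (subtopology euclideanreal {0..1}) K \<and> openin X U}"
        by (intro CollectI exI[of _ "{}"]) simp
    qed (use \<gamma> in simp)
  qed auto
  finally show ?thesis .
qed

definition power_space :: "nat \<Rightarrow> 'a topology \<Rightarrow> (nat \<Rightarrow> 'a) topology" where
  "power_space r X = product_topology (\<lambda>_. X) {1..r}"

definition eval_at :: "nat \<Rightarrow> (nat \<Rightarrow> real) \<Rightarrow> (real \<Rightarrow> 'a) \<Rightarrow> (nat \<Rightarrow> 'a)" where
  "eval_at r t \<gamma> = (\<lambda>i\<in>{1..r}. \<gamma> (t i))"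


section \<open>Sectional categories\<close>

definition section_over ::
  "'e topology \<Rightarrow> 'b topology \<Rightarrow> ('e \<Rightarrow> 'b) \<Rightarrow> 'b set \<Rightarrow> bool" where
  "section_over E B q U \<longleftrightarrow>
     (\<exists>s. continuous_map (subtopology B U) E s \<and> (\<forall>b \<in> topspace B \<inter> U. q (s b) = b))"

text \<open>
  In the three numerical invariants below the infimum of the empty set of extended natural numbers
  is \<open>\<infinity>\<close>. The definitions make sense for every map \<open>q\<close>, fibration or not.
\<close>

definition secat :: "'e topology \<Rightarrow> 'b topology \<Rightarrow> ('e \<Rightarrow> 'b) \<Rightarrow> enat" where
  "secat E B q = Inf {enat k |k. \<exists>U :: nat \<Rightarrow> 'b set.
     (\<forall>i\<le>k. openin B (U i) \<and> section_over E B q (U i)) \<and>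
     topspace B \<subseteq> (\<Union>i\<le>k. U i)}"

definition secat_wrt ::
  "('b \<Rightarrow> 'c) \<Rightarrow> 'c topology \<Rightarrow> 'e topology \<Rightarrow> 'b topology \<Rightarrow> ('e \<Rightarrow> 'b) \<Rightarrow> enat" where
  "secat_wrt f C E B q = Inf {enat k |k. \<exists>U :: nat \<Rightarrow> 'c set.
     (\<forall>i\<le>k. openin C (U i) \<and> section_over E B q {b \<in> topspace B. f b \<in> U i}) \<and>
     f ` topspace B \<subseteq> (\<Union>i\<le>k. U i)}"


section \<open>Sequential parametrized topological complexity\<close>

definition fibre_power :: "nat \<Rightarrow> 'e topology \<Rightarrow> ('e \<Rightarrow> 'b) \<Rightarrow> (nat \<Rightarrow> 'e) topology" where
  "fibre_power r E p =
     subtopology (power_space r E) {e. \<forall>i\<in>{1..r}. \<forall>j\<in>{1..r}. p (e i) = p (e j)}"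

definition fibre_paths :: "'e topology \<Rightarrow> ('e \<Rightarrow> 'b) \<Rightarrow> (real \<Rightarrow> 'e) topology" where
  "fibre_paths E p =
     subtopology (path_space E) {\<gamma>. \<forall>a\<in>{0..1}. \<forall>b\<in>{0..1}. p (\<gamma> a) = p (\<gamma> b)}"

definition param_TC ::
  "nat \<Rightarrow> (nat \<Rightarrow> real) \<Rightarrow> 'e topology \<Rightarrow> ('e \<Rightarrow> 'b) \<Rightarrow> enat" where
  "param_TC r t E p = secat (fibre_paths E p) (fibre_power r E p) (eval_at r t)"


section \<open>Topological groups, actions and orbit spaces\<close>

definition topological_group :: "('g, 'm) monoid_scheme \<Rightarrow> 'g topology \<Rightarrow> bool" where
  "topological_group G TG \<longleftrightarrow>
     group G \<and> topspace TG = carrier G \<and>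
     continuous_map (prod_topology TG TG) TG (\<lambda>(g, h). g \<otimes>\<^bsub>G\<^esub> h) \<and>
     continuous_map TG TG (\<lambda>g. inv\<^bsub>G\<^esub> g)"

definition continuous_action ::
  "('g, 'm) monoid_scheme \<Rightarrow> 'g topology \<Rightarrow> 'x topology \<Rightarrow> ('g \<Rightarrow> 'x \<Rightarrow> 'x) \<Rightarrow> bool" where
  "continuous_action G TG X \<phi> \<longleftrightarrow>
     group_action G (topspace X) \<phi> \<and>
     continuous_map (prod_topology TG X) X (\<lambda>(g, x). \<phi> g x)"

definition power_action :: "nat \<Rightarrow> ('g \<Rightarrow> 'x \<Rightarrow> 'x) \<Rightarrow> 'g \<Rightarrow> (nat \<Rightarrow> 'x) \<Rightarrow> (nat \<Rightarrow> 'x)" where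
  "power_action r \<phi> g x = (\<lambda>i\<in>{1..r}. \<phi> g (x i))"

definition diagonal_action ::
  "('g \<Rightarrow> 'x \<Rightarrow> 'x) \<Rightarrow> ('g \<Rightarrow> 'p \<Rightarrow> 'p) \<Rightarrow> 'g \<Rightarrow> 'x \<times> 'p \<Rightarrow> 'x \<times> 'p" where
  "diagonal_action \<phi> \<psi> g = (\<lambda>(x, e). (\<phi> g x, \<psi> g e))"

definition orbit_space ::
  "('g, 'm) monoid_scheme \<Rightarrow> 'x topology \<Rightarrow> ('g \<Rightarrow> 'x \<Rightarrow> 'x) \<Rightarrow> 'x set topology" where
  "orbit_space G X \<phi> = topology (\<lambda>U. U \<subseteq> orbits G (topspace X) \<phi> \<and>
     openin X {x \<in> topspace X. orbit G \<phi> x \<in> U})"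

lemma openin_orbit_space:
  "openin (orbit_space G X \<phi>) U \<longleftrightarrow>
     U \<subseteq> orbits G (topspace X) \<phi> \<and> openin X {x \<in> topspace X. orbit G \<phi> x \<in> U}"
proof -
  have "istopology (\<lambda>U. U \<subseteq> orbits G (topspace X) \<phi> \<and>
     openin X {x \<in> topspace X. orbit G \<phi> x \<in> U})"
    unfolding istopology_def
  proof (intro conjI allI impI)
    fix S T
    assume "S \<subseteq> orbits G (topspace X) \<phi> \<and> openin X {x \<in> topspace X. orbit G \<phi> x \<in> S}"
      and "T \<subseteq> orbits G (topspace X) \<phi> \<and> openin X {x \<in> topspace X. orbit G \<phi> x \<in> T}"
    moreover have "{x \<in> topspace X. orbit G \<phi> x \<in> S \<inter> T} =
        {x \<in> topspace X. orbit G \<phi> x \<in> S} \<inter> {x \<in> topspace X. orbit G \<phi> x \<in> T}"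
      by auto
    ultimately show "S \<inter> T \<subseteq> orbits G (topspace X) \<phi>"
      and "openin X {x \<in> topspace X. orbit G \<phi> x \<in> S \<inter> T}"
      by auto
  next
    fix \<K>
    assume *: "\<forall>K\<in>\<K>. K \<subseteq> orbits G (topspace X) \<phi> \<and>
      openin X {x \<in> topspace X. orbit G \<phi> x \<in> K}"
    then show "\<Union>\<K> \<subseteq> orbits G (topspace X) \<phi>"
      by auto
    have "{x \<in> topspace X. orbit G \<phi> x \<in> \<Union>\<K>} =
        \<Union>((\<lambda>K. {x \<in> topspace X. orbit G \<phi> x \<in> K}) ` \<K>)"
      by auto
    with * show "openin X {x \<in> topspace X. orbit G \<phi> x \<in> \<Union>\<K>}"
      by auto
  qed
  then show ?thesis
    by (simp add: orbit_space_def topology_inverse')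
qed

lemma quotient_map_orbit: "quotient_map X (orbit_space G X \<phi>) (orbit G \<phi>)"
proof -
  have "{x \<in> topspace X. orbit G \<phi> x \<in> orbits G (topspace X) \<phi>} = topspace X"
    by (auto simp: orbits_def)
  then have "openin (orbit_space G X \<phi>) (orbits G (topspace X) \<phi>)"
    by (simp add: openin_orbit_space)
  then have "topspace (orbit_space G X \<phi>) = orbits G (topspace X) \<phi>"
    by (metis openin_orbit_space openin_subset openin_topspace subset_antisym)
  then show ?thesis
    by (auto simp: quotient_map_def openin_orbit_space orbits_def)
qed


section \<open>Principal bundles and associated bundles\<close>

text \<open>
  Groups act on the left throughout, also on the total space \<open>P\<close> of a principal bundle (a right
  action is turned into a left one by \<open>g e = e g\<inverse>\<close>). A local trivialization is an equivariant
  homeomorphism \<open>U \<times> G \<rightarrow> \<tau>\<inverse>(U)\<close> over \<open>U\<close>, where \<open>G\<close> acts on \<open>U \<times> G\<close> by left translations of the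
  second factor.
\<close>

definition principal_trivialization ::
  "('g, 'm) monoid_scheme \<Rightarrow> 'g topology \<Rightarrow> 'p topology \<Rightarrow> ('g \<Rightarrow> 'p \<Rightarrow> 'p) \<Rightarrow> 'b topology \<Rightarrow>
   ('p \<Rightarrow> 'b) \<Rightarrow> 'b set \<Rightarrow> ('b \<times> 'g \<Rightarrow> 'p) \<Rightarrow> bool" where
  "principal_trivialization G TG P \<psi> B \<tau> U \<Psi> \<longleftrightarrow>
     homeomorphic_map (prod_topology (subtopology B U) TG)
       (subtopology P {e \<in> topspace P. \<tau> e \<in> U}) \<Psi> \<and>
     (\<forall>b\<in>U. \<forall>h\<in>carrier G. \<tau> (\<Psi> (b, h)) = b) \<and>
     (\<forall>b\<in>U. \<forall>g\<in>carrier G. \<forall>h\<in>carrier G. \<Psi> (b, g \<otimes>\<^bsub>G\<^esub> h) = \<psi> g (\<Psi> (b, h)))"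

definition principal_bundle ::
  "('g, 'm) monoid_scheme \<Rightarrow> 'g topology \<Rightarrow> 'p topology \<Rightarrow> ('g \<Rightarrow> 'p \<Rightarrow> 'p) \<Rightarrow> 'b topology \<Rightarrow>
   ('p \<Rightarrow> 'b) \<Rightarrow> bool" where
  "principal_bundle G TG P \<psi> B \<tau> \<longleftrightarrow>
     continuous_action G TG P \<psi> \<and> continuous_map P B \<tau> \<and>
     (\<forall>b\<in>topspace B. \<exists>U \<Psi>. openin B U \<and> b \<in> U \<and> principal_trivialization G TG P \<psi> B \<tau> U \<Psi>)"

definition assoc_space ::
  "('g, 'm) monoid_scheme \<Rightarrow> 'x topology \<Rightarrow> ('g \<Rightarrow> 'x \<Rightarrow> 'x) \<Rightarrow> 'p topology \<Rightarrow> ('g \<Rightarrow> 'p \<Rightarrow> 'p) \<Rightarrow>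
   ('x \<times> 'p) set topology" where
  "assoc_space G X \<phi> P \<psi> = orbit_space G (prod_topology X P) (diagonal_action \<phi> \<psi>)"

text \<open>
  The map \<open>[x, e] \<mapsto> \<tau> e\<close>: since \<open>\<tau>\<close> is constant on orbits, \<open>\<tau> \<circ> snd\<close> takes exactly one value on
  each point \<open>[x, e]\<close> of the associated space, that point being an orbit.
\<close>

definition assoc_proj :: "('p \<Rightarrow> 'b) \<Rightarrow> ('x \<times> 'p) set \<Rightarrow> 'b" where
  "assoc_proj \<tau> c = the_elem ((\<tau> \<circ> snd) ` c)"

text \<open>
  Triviality over \<open>U\<close> as a \<open>G\<close>-bundle, not just as a bundle with fibre \<open>X\<close>: a trivialization of
  the associated bundle that is induced by one of the principal bundle \<open>P\<close>, namely
  \<open>X \<times> U \<cong> X \<times>\<^sub>G (U \<times> G) \<cong> X \<times>\<^sub>G \<tau>\<inverse>(U)\<close>. Without the reference to \<open>P\<close> the structure group would be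
  lost, in particular when it does not act effectively on \<open>X\<close>.
\<close>

definition trivial_G_bundle_over ::
  "('g, 'm) monoid_scheme \<Rightarrow> 'g topology \<Rightarrow> 'x topology \<Rightarrow> ('g \<Rightarrow> 'x \<Rightarrow> 'x) \<Rightarrow> 'p topology \<Rightarrow>
   ('g \<Rightarrow> 'p \<Rightarrow> 'p) \<Rightarrow> 'b topology \<Rightarrow> ('p \<Rightarrow> 'b) \<Rightarrow> 'b set \<Rightarrow> bool" where
  "trivial_G_bundle_over G TG X \<phi> P \<psi> B \<tau> U \<longleftrightarrow>
     (\<exists>\<Psi>. principal_trivialization G TG P \<psi> B \<tau> U \<Psi> \<and>
        homeomorphic_map (prod_topology X (subtopology B U))
          (subtopology (assoc_space G X \<phi> P \<psi>)
             {c \<in> topspace (assoc_space G X \<phi> P \<psi>). assoc_proj \<tau> c \<in> U})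
          (\<lambda>(x, b). orbit G (diagonal_action \<phi> \<psi>) (x, \<Psi> (b, \<one>\<^bsub>G\<^esub>))))"

definition G_cat ::
  "('g, 'm) monoid_scheme \<Rightarrow> 'g topology \<Rightarrow> 'x topology \<Rightarrow> ('g \<Rightarrow> 'x \<Rightarrow> 'x) \<Rightarrow> 'p topology \<Rightarrow>
   ('g \<Rightarrow> 'p \<Rightarrow> 'p) \<Rightarrow> 'b topology \<Rightarrow> ('p \<Rightarrow> 'b) \<Rightarrow> enat" where
  "G_cat G TG X \<phi> P \<psi> B \<tau> = Inf {enat k |k. \<exists>U :: nat \<Rightarrow> 'b set.
     (\<forall>i\<le>k. openin B (U i) \<and> trivial_G_bundle_over G TG X \<phi> P \<psi> B \<tau> (U i)) \<and>
     topspace B = (\<Union>i\<le>k. U i)}"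


section \<open>The weak invariant with coefficients\<close>

definition weak_TC ::
  "nat \<Rightarrow> (nat \<Rightarrow> real) \<Rightarrow> ('g, 'm) monoid_scheme \<Rightarrow> 'x topology \<Rightarrow> ('g \<Rightarrow> 'x \<Rightarrow> 'x) \<Rightarrow>
   'p topology \<Rightarrow> ('g \<Rightarrow> 'p \<Rightarrow> 'p) \<Rightarrow> enat" where
  "weak_TC r s G X \<phi> P \<psi> =
     secat_wrt (orbit G (diagonal_action (power_action r \<phi>) \<psi>))
       (assoc_space G (power_space r X) (power_action r \<phi>) P \<psi>)
       (prod_topology (path_space X) P) (prod_topology (power_space r X) P)
       (\<lambda>(\<gamma>, e). (eval_at r s \<gamma>, e))"

end

theory Submission
  imports Defs
begin

text \<open>
  A point \<open>e\<close> of \<open>P\<close> over \<open>b\<close> identifies the fibre \<open>E\<^sub>b\<close> with \<open>X\<close> by \<open>[x, e] \<mapsto> x\<close>, continuously in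
  the point of the fibre and in \<open>e\<close>. Lower bound: a section of \<open>\<Pi>\<^sub>r\<close> over \<open>U\<close> gives for
  \<open>(x, e) \<in> X\<^sup>r \<times> P\<close> with \<open>([x\<^sub>i, e])\<^sub>i \<in> U\<close> a path in \<open>E\<^sub>b\<close>, hence a path in \<open>X\<close> through the points
  \<open>x\<^sub>i\<close>; a reparametrization of the interval exchanges the two families of times. Upper bound: over
  a set \<open>U\<^sub>i\<close> where \<open>P\<close> has a section, points of \<open>E\<^sup>r\<^sub>B\<close> lift to \<open>X\<^sup>r \<times> P\<close>, and sections over the
  preimage of \<open>V\<^sub>j\<close> in \<open>X\<^sup>r \<times> P\<close> give sections of \<open>\<Pi>\<^sub>r\<close>. To get by with \<open>k + l + 1\<close> open sets,
  take bump functions \<open>f\<^sub>i\<close> supported in \<open>U\<^sub>i\<close> and, for each \<open>j \<le> l\<close>, the cover of \<open>B\<close> by the sets on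
  which \<open>i\<close> is, up to a tolerance, the first index with \<open>f\<^sub>i > j / (l + 1)\<close>. With these thresholds
  the pieces belonging to \<open>(i, j)\<close> with the same \<open>i + j\<close> are disjoint, so their sections can be
  glued. Only \<open>B\<close> has to be normal, since the cover \<open>V\<^sub>j\<close> is not refined.
\<close>


section \<open>Continuous maps\<close>

lemma continuous_map_compose2:
  assumes "continuous_map Y Z g" "continuous_map X Y f"
  shows "continuous_map X Z (\<lambda>x. g (f x))"
  using continuous_map_compose[OF assms(2,1)] by (simp add: o_def)

lemma continuous_map_locally:
  assumes "\<And>x. x \<in> topspace X \<Longrightarrow>
    \<exists>T. openin X T \<and> x \<in> T \<and> continuous_map (subtopology X T) Y f"
  shows "continuous_map X Y f"
proof (rule pasting_lemma)
  let ?I = "{T. openin X T \<and> continuous_map (subtopology X T) Y f}"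
  show "openin X T" if "T \<in> ?I" for T
    using that by simp
  show "continuous_map (subtopology X T) Y f" if "T \<in> ?I" for T
    using that by simp
  show "\<exists>T. T \<in> ?I \<and> x \<in> T \<and> f x = f x" if "x \<in> topspace X" for x
    using assms[OF that] by blast
qed simp

section \<open>Path spaces: currying and evaluation\<close>

text \<open>This half of the exponential law rests on the tube lemma: if \<open>h\<close> sends
  \<open>{z} \<times> K\<close> into \<open>U\<close> and \<open>K\<close> is compact, then it sends
  \<open>A \<times> K\<close> into \<open>U\<close> for some neighbourhood \<open>A\<close> of
  \<open>z\<close>. Hence preimages of subbasic sets are open.\<close>

lemma path_space_curry:
  assumes h: "continuous_map (prod_topology Z (top_of_set {0..1})) X (\<lambda>(z, u). h z u)"
  shows "continuous_map Z (path_space X) (\<lambda>z. \<lambda>u\<in>{0..1}. h z u)"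
proof -
  let ?I = "top_of_set {0..1::real}"
  let ?f = "\<lambda>z. \<lambda>u\<in>{0..1}. h z u"
  have path: "pathin X (?f z)" if "z \<in> topspace Z" for z
  proof -
    have "continuous_map ?I (prod_topology Z ?I) (\<lambda>u. (z, u))"
      using that by (intro continuous_map_pairedI) auto
    from continuous_map_compose2[OF h this] have "continuous_map ?I X (h z)"
      by simp
    then show ?thesis
      unfolding pathin_def by (rule continuous_map_eq) auto
  qed
  have f_in: "?f z \<in> {\<gamma> \<in> extensional {0..1}. pathin X \<gamma>}" if "z \<in> topspace Z" for z
    using path[OF that] by simp
  have "openin Z (?f -` {\<gamma> \<in> extensional {0..1}. pathin X \<gamma> \<and> \<gamma> ` K \<subseteq> U} \<inter> topspace Z)"
    (is "openin Z ?S") if K: "compactin ?I K" and U: "openin X U" for K U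
  proof -
    let ?W = "{x \<in> topspace (prod_topology Z ?I). (\<lambda>(z, u). h z u) x \<in> U}"
    have W: "openin (prod_topology Z ?I) ?W"
      using openin_continuous_map_preimage[OF h U] .
    have K01: "K \<subseteq> {0..1}"
      using compactin_subset_topspace[OF K] by simp
    show ?thesis
    proof (subst openin_subopen, intro ballI)
      fix z assume z: "z \<in> ?S"
      have zK: "{z} \<times> K \<subseteq> ?W"
      proof
        fix y assume "y \<in> {z} \<times> K"
        then obtain u where u: "y = (z, u)" "u \<in> K" by auto
        then have "u \<in> {0..1}" "?f z u \<in> U"
          using z K01 by (auto simp del: restrict_apply)
        then show "y \<in> ?W"
          using z u(1) by auto
      qed
      have "compactin Z {z}"
        using z by simp
      from this K W zK obtain A V where AV: "openin Z A" "openin ?I V" "{z} \<subseteq> A" "K \<subseteq> V" "A \<times> V \<subseteq> ?W"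
        by (rule Wallace_theorem_prod_topology)
      have "A \<subseteq> ?S"
      proof
        fix y assume y: "y \<in> A"
        have yZ: "y \<in> topspace Z"
          using AV(1) y openin_subset by blast
        have "h y u \<in> U" if "u \<in> K" for u
        proof -
          have "(y, u) \<in> ?W"
            using AV(4,5) y that by blast
          then show ?thesis by simp
        qed
        then show "y \<in> ?S"
          using yZ path[OF yZ] K01 by auto
      qed
      then show "\<exists>T. openin Z T \<and> z \<in> T \<and> T \<subseteq> ?S"
        using AV by blast
    qed
  qed
  moreover have "?f ` topspace Z \<subseteq> topspace (path_space X)"
    unfolding topspace_path_space using f_in by blast
  ultimately show ?thesis
    unfolding path_space_def topology_generated_by_topspace
    by (intro continuous_on_generated_topo) blast+
qed

text \<open>Here local compactness of the interval enters. If \<gamma> sends \<open>u\<close> into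
  \<open>U\<close>, it sends a small closed ball \<open>K\<close> around \<open>u\<close> into
  \<open>U\<close>, and \<open>K\<close> is compact, so it defines a subbasic neighbourhood of
  \<gamma>.\<close>

lemma path_space_eval:
  "continuous_map (prod_topology (path_space X) (top_of_set {0..1})) X (\<lambda>(\<gamma>, u). \<gamma> u)"
proof -
  let ?I = "top_of_set {0..1::real}"
  let ?PI = "prod_topology (path_space X) ?I"
  have "openin ?PI {x \<in> topspace ?PI. (\<lambda>(\<gamma>, u). \<gamma> u) x \<in> U}" (is "openin ?PI ?S")
    if U: "openin X U" for U
  proof (subst openin_subopen, intro ballI)
    fix x assume x: "x \<in> ?S"
    obtain \<gamma> u where xeq: "x = (\<gamma>, u)"
      by (cases x)
    have \<gamma>: "\<gamma> \<in> extensional {0..1}" "continuous_map ?I X \<gamma>" and u: "u \<in> {0..1}" "\<gamma> u \<in> U"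
      using x by (auto simp: xeq topspace_path_space pathin_def)
    have "openin ?I {v \<in> topspace ?I. \<gamma> v \<in> U}"
      using openin_continuous_map_preimage[OF \<gamma>(2) U] .
    then have "\<forall>x \<in> {v \<in> topspace ?I. \<gamma> v \<in> U}.
        \<exists>e>0. ball x e \<inter> {0..1} \<subseteq> {v \<in> topspace ?I. \<gamma> v \<in> U}"
      unfolding openin_contains_ball by blast
    moreover have "u \<in> {v \<in> topspace ?I. \<gamma> v \<in> U}"
      using u by simp
    ultimately obtain e where e: "e > 0" "ball u e \<inter> {0..1} \<subseteq> {v \<in> topspace ?I. \<gamma> v \<in> U}"
      by blast
    define K where "K = cball u (e/2) \<inter> {0..1}"
    have "compact K"
      unfolding K_def by (intro compact_Int_closed) auto
    then have K: "compactin ?I K"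
      by (simp add: compactin_subtopology K_def)
    let ?A = "{\<gamma> \<in> extensional {0..1}. pathin X \<gamma> \<and> \<gamma> ` K \<subseteq> U}"
    have "openin (path_space X) ?A"
      unfolding path_space_def using K U by (intro topology_generated_by_Basis) blast
    moreover have "openin ?I (ball u (e/2) \<inter> {0..1})"
      by (simp add: openin_open_Int Int_commute)
    ultimately have "openin ?PI (?A \<times> (ball u (e/2) \<inter> {0..1}))"
      by (simp add: openin_prod_Times_iff)
    moreover have "x \<in> ?A \<times> (ball u (e/2) \<inter> {0..1})"
      using e u \<gamma> by (auto simp: xeq K_def pathin_def subset_iff)
    moreover have "?A \<times> (ball u (e/2) \<inter> {0..1}) \<subseteq> ?S"
      by (auto simp: topspace_path_space K_def image_subset_iff)
    ultimately show "\<exists>T. openin ?PI T \<and> x \<in> T \<and> T \<subseteq> ?S"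
      by blast
  qed
  then show ?thesis
    by (auto simp: continuous_map_def topspace_path_space pathin_def Pi_iff)
qed

section \<open>Auxiliary real functions: change of times and bump functions\<close>

text \<open>The assignment \<open>a j \<mapsto> b j\<close> is a continuous function on a finite,
  hence closed and discrete, set of reals, and Tietze's theorem extends it with values in the unit
  interval. Precomposing a path with \<theta> moves its values from the times \<open>b\<close> to
  the times \<open>a\<close>.\<close>

lemma unit_interval_reparametrization:
  fixes a b :: "nat \<Rightarrow> real"
  assumes "inj_on a J" "finite J" "b ` J \<subseteq> {0..1}"
  obtains \<theta> where "continuous_map (top_of_set {0..1}) (top_of_set {0..1}) \<theta>"
    "\<And>j. j \<in> J \<Longrightarrow> \<theta> (a j) = b j"
proof -
  let ?f = "\<lambda>x. b (inv_into J a x)"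
  have "continuous_on (a ` J) ?f"
    using assms(2) by (intro continuous_on_finite) auto
  moreover have "closedin (top_of_set UNIV) (a ` J)"
    using assms(2) by (simp add: finite_imp_closed)
  moreover have "?f x \<in> cbox 0 1" if "x \<in> a ` J" for x
    using that assms(3) inv_into_into[OF that] by auto
  ultimately obtain \<theta> where \<theta>: "continuous_on UNIV \<theta>" "\<And>x. x \<in> a ` J \<Longrightarrow> \<theta> x = ?f x"
    "\<And>x. x \<in> UNIV \<Longrightarrow> \<theta> x \<in> cbox 0 1"
    using Tietze_closed_interval[of "a ` J" ?f UNIV 0 1] by auto
  show ?thesis
  proof
    show "continuous_map (top_of_set {0..1}) (top_of_set {0..1}) \<theta>"
      using \<theta>(1,3) by (auto simp: continuous_map_in_subtopology intro: continuous_on_subset)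
    show "\<theta> (a j) = b j" if "j \<in> J" for j
      using that assms(1) \<theta>(2) by simp
  qed
qed

text \<open>Induction on \<open>n\<close>, for all closed \<open>S\<close> at once: a Urysohn
  function for the last set takes care of a part of \<open>S\<close>, and what is left is a smaller
  closed set covered by the earlier \<open>U i\<close>.\<close>

lemma normal_space_bump_functions:
  fixes U :: "nat \<Rightarrow> 'b set"
  assumes "normal_space B" "closedin B S" "\<And>i. i < n \<Longrightarrow> openin B (U i)" "S \<subseteq> (\<Union>i<n. U i)"
  obtains f :: "nat \<Rightarrow> 'b \<Rightarrow> real"
  where "\<And>i. i < n \<Longrightarrow> continuous_map B euclideanreal (f i)"
    "\<And>i b. i < n \<Longrightarrow> b \<in> topspace B - U i \<Longrightarrow> f i b = 0"
    "\<And>b. b \<in> S \<Longrightarrow> \<exists>i<n. f i b = 1"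
proof -
  have "\<exists>f :: nat \<Rightarrow> 'b \<Rightarrow> real. (\<forall>i<n. continuous_map B euclideanreal (f i)) \<and>
    (\<forall>i<n. \<forall>b \<in> topspace B - U i. f i b = 0) \<and> (\<forall>b\<in>S. \<exists>i<n. f i b = 1)"
    using assms(2-4)
  proof (induction n arbitrary: S)
    case 0
    then show ?case by auto
  next
    case (Suc n)
    have Ui: "openin B (U i)" if "i \<le> n" for i
      using Suc.prems that by auto
    \<comment> \<open>The part of \<open>S\<close> that only \<open>U n\<close> can cover. It is
      closed, and so is the complement of \<open>U n\<close>, so that a Urysohn function
      \<open>g\<close> separates them.\<close>
    define T where "T = S - (\<Union>i<n. U i)"
    have T: "closedin B T"
      unfolding T_def using Suc.prems(1) Ui by (intro closedin_diff openin_Union) auto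
    have "T \<subseteq> U n"
      using Suc.prems(3) by (auto simp: T_def lessThan_Suc)
    then have "disjnt (topspace B - U n) T"
      by (auto simp: disjnt_def)
    then obtain g where g: "continuous_map B (top_of_set {0..1::real}) g"
        "g ` (topspace B - U n) \<subseteq> {0}" "g ` T \<subseteq> {1}"
      using Urysohn_lemma[OF assms(1) _ T, of "topspace B - U n" 0 1] Ui[of n] by auto
    have g': "continuous_map B euclideanreal g"
      using g(1) by (simp add: continuous_map_in_subtopology)
    define S' where "S' = S \<inter> {b \<in> topspace B. g b \<in> {..1/2}}"
    have "closedin B S'"
      unfolding S'_def using Suc.prems(1)
      by (intro closedin_Int closedin_continuous_map_preimage[OF g']) auto
    moreover have "S' \<subseteq> (\<Union>i<n. U i)"
      using g(3) by (fastforce simp: S'_def T_def)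
    ultimately obtain f where f: "\<forall>i<n. continuous_map B euclideanreal (f i)"
        "\<forall>i<n. \<forall>b \<in> topspace B - U i. f i b = (0::real)" "\<forall>b\<in>S'. \<exists>i<n. f i b = 1"
      using Suc.IH[of S'] Ui by auto
    \<comment> \<open>Doubling and capping gives the value 1 wherever \<open>g b > 1/2\<close>, that
      is on \<open>S - S'\<close>. On \<open>S'\<close> one of the earlier functions takes the value
      1.\<close>
    define f' where "f' = f(n := \<lambda>b. min 1 (2 * g b))"
    have "continuous_map B euclideanreal (\<lambda>b. min 1 (2 * g b))"
      using g' by (intro continuous_intros) auto
    then have "\<forall>i<Suc n. continuous_map B euclideanreal (f' i)"
      using f(1) by (auto simp: f'_def less_Suc_eq)
    moreover have "\<forall>i<Suc n. \<forall>b \<in> topspace B - U i. f' i b = 0"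
      using f(2) g(2) by (auto simp: f'_def less_Suc_eq image_subset_iff)
    moreover have "\<exists>i<Suc n. f' i b = 1" if b: "b \<in> S" for b
    proof (cases "b \<in> S'")
      case True
      then obtain i where "i < n" "f i b = 1"
        using f(3) by blast
      then show ?thesis
        by (intro exI[of _ i]) (auto simp: f'_def)
    next
      case False
      then have "g b > 1/2"
        using b closedin_subset[OF Suc.prems(1)] by (auto simp: S'_def)
      then show ?thesis
        by (intro exI[of _ n]) (auto simp: f'_def)
    qed
    ultimately show ?case by blast
  qed
  then show ?thesis
    using that by blast
qed

section \<open>Sections over open sets\<close>

text \<open>Over disjoint open sets the sections have nothing to agree on, so the pasting lemma
  applies. This allows several pieces of a cover to share one index.\<close>

lemma section_over_disjoint_Union:
  assumes "\<And>j. j \<in> J \<Longrightarrow> openin B (W j)" "\<And>j. j \<in> J \<Longrightarrow> section_over E B q (W j)"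
    and "disjoint_family_on W J"
  shows "section_over E B q (\<Union>j\<in>J. W j)"
proof -
  obtain s where s: "\<And>j. j \<in> J \<Longrightarrow> continuous_map (subtopology B (W j)) E (s j)"
      "\<And>j b. j \<in> J \<Longrightarrow> b \<in> topspace B \<inter> W j \<Longrightarrow> q (s j b) = b"
    using assms(2) unfolding section_over_def by metis
  let ?U = "\<Union>j\<in>J. W j"
  obtain g where g: "continuous_map (subtopology B ?U) E g"
      "\<And>x j. \<lbrakk>j \<in> J; x \<in> topspace (subtopology B ?U) \<inter> W j\<rbrakk> \<Longrightarrow> g x = s j x"
  proof (rule pasting_lemma_exists[of "subtopology B ?U" W J E s])
    show "topspace (subtopology B ?U) \<subseteq> ?U"
      by auto
    show "openin (subtopology B ?U) (W j)" if "j \<in> J" for j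
      using assms(1)[OF that] that by (auto simp: openin_subtopology)
    show "continuous_map (subtopology (subtopology B ?U) (W j)) E (s j)" if "j \<in> J" for j
    proof -
      have "?U \<inter> W j = W j"
        using that by auto
      then show ?thesis
        using s(1)[OF that] by (simp add: subtopology_subtopology)
    qed
    show "s i x = s j x" if "i \<in> J" "j \<in> J" "x \<in> topspace (subtopology B ?U) \<inter> W i \<inter> W j" for i j x
      using that assms(3) by (cases "i = j") (auto simp: disjoint_family_on_def)
  qed auto
  show ?thesis
    unfolding section_over_def
  proof (intro exI conjI ballI)
    show "continuous_map (subtopology B ?U) E g"
      by fact
    fix b assume b: "b \<in> topspace B \<inter> ?U"
    then obtain j where j: "j \<in> J" "b \<in> W j" "b \<in> topspace B"
      by auto
    then show "q (g b) = b"
      using g(2)[of j b] s(2)[of j b] b by simp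
  qed
qed


section \<open>Group actions on sets\<close>

text \<open>
  Unlike \<^const>\<open>group_action\<close>, this does not ask the action to be extensional; the diagonal action
  and the action on powers are not.
\<close>

definition acts :: "('g, 'm) monoid_scheme \<Rightarrow> 'x set \<Rightarrow> ('g \<Rightarrow> 'x \<Rightarrow> 'x) \<Rightarrow> bool" where
  "acts G S \<phi> \<longleftrightarrow>
     (\<forall>g\<in>carrier G. \<forall>x\<in>S. \<phi> g x \<in> S) \<and> (\<forall>x\<in>S. \<phi> \<one>\<^bsub>G\<^esub> x = x) \<and>
     (\<forall>g\<in>carrier G. \<forall>h\<in>carrier G. \<forall>x\<in>S. \<phi> (g \<otimes>\<^bsub>G\<^esub> h) x = \<phi> g (\<phi> h x))"

lemma group_action_imp_acts:
  assumes "group_action G S \<phi>"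
  shows "acts G S \<phi>"
proof -
  interpret group_action G S \<phi> by fact
  show ?thesis
    unfolding acts_def
  proof (intro conjI ballI)
    show "\<phi> \<one>\<^bsub>G\<^esub> x = x" if "x \<in> S" for x
      using that by (simp flip: id_eq_one)
  qed (auto intro: element_image composition_rule)
qed

lemma acts_diagonal:
  "acts G S \<phi> \<Longrightarrow> acts G T \<psi> \<Longrightarrow> acts G (S \<times> T) (diagonal_action \<phi> \<psi>)"
  by (auto simp: acts_def diagonal_action_def)

lemma acts_power:
  "acts G S \<phi> \<Longrightarrow> acts G (PiE {1..r} (\<lambda>_. S)) (power_action r \<phi>)"
  by (auto simp: acts_def power_action_def PiE_iff extensional_def fun_eq_iff)

lemma orbit_acts:
  assumes G: "group G" and S: "acts G S \<phi>" and x: "x \<in> S" and g: "g \<in> carrier G"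
  shows "orbit G \<phi> (\<phi> g x) = orbit G \<phi> x"
proof -
  interpret group G by fact
  have 1: "\<phi> h (\<phi> g x) = \<phi> (h \<otimes>\<^bsub>G\<^esub> g) x" if "h \<in> carrier G" for h
    using S x g that by (simp add: acts_def)
  have 2: "\<phi> h x = \<phi> (h \<otimes>\<^bsub>G\<^esub> inv\<^bsub>G\<^esub> g) (\<phi> g x)" if h: "h \<in> carrier G" for h
    using 1[of "h \<otimes>\<^bsub>G\<^esub> inv\<^bsub>G\<^esub> g"] g h by (simp add: m_assoc)
  show ?thesis
  proof (intro subset_antisym subsetI)
    fix y assume "y \<in> orbit G \<phi> (\<phi> g x)"
    then obtain h where "h \<in> carrier G" "y = \<phi> h (\<phi> g x)"
      by (auto simp: orbit_def)
    with 1 g show "y \<in> orbit G \<phi> x"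
      by (auto simp: orbit_def)
  next
    fix y assume "y \<in> orbit G \<phi> x"
    then obtain h where "h \<in> carrier G" "y = \<phi> h x"
      by (auto simp: orbit_def)
    with 2[of h] g show "y \<in> orbit G \<phi> (\<phi> g x)"
      unfolding orbit_def by (intro CollectI exI[of _ "h \<otimes>\<^bsub>G\<^esub> inv\<^bsub>G\<^esub> g"]) simp
  qed
qed

lemma orbit_eq_acts_iff:
  assumes G: "group G" and S: "acts G S \<phi>" and x: "x \<in> S" and y: "y \<in> S"
  shows "orbit G \<phi> x = orbit G \<phi> y \<longleftrightarrow> (\<exists>g\<in>carrier G. \<phi> g x = y)"
proof
  interpret group G by fact
  assume "orbit G \<phi> x = orbit G \<phi> y"
  moreover have "y \<in> orbit G \<phi> y"
    using S y one_closed unfolding orbit_def acts_def by force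
  ultimately have "y \<in> orbit G \<phi> x"
    by simp
  then show "\<exists>g\<in>carrier G. \<phi> g x = y"
    by (auto simp: orbit_def)
qed (use orbit_acts[OF G S x] in auto)


section \<open>Fibre coordinates in an associated bundle\<close>

locale associated_bundle =
  fixes G :: "('g, 'm) monoid_scheme" and TG :: "'g topology"
    and X :: "'x topology" and \<phi> :: "'g \<Rightarrow> 'x \<Rightarrow> 'x"
    and P :: "'p topology" and \<psi> :: "'g \<Rightarrow> 'p \<Rightarrow> 'p"
    and B :: "'b topology" and \<tau> :: "'p \<Rightarrow> 'b"
  assumes topological_group: "topological_group G TG"
    and fibre_action: "continuous_action G TG X \<phi>"
    and principal_bundle: "principal_bundle G TG P \<psi> B \<tau>"
begin

abbreviation E where "E \<equiv> assoc_space G X \<phi> P \<psi>"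
abbreviation Q where "Q \<equiv> orbit G (diagonal_action \<phi> \<psi>)"
abbreviation p :: "('x \<times> 'p) set \<Rightarrow> 'b" where "p \<equiv> assoc_proj \<tau>"

sublocale group G
  using topological_group by (simp add: topological_group_def)

lemma topspace_TG: "topspace TG = carrier G"
  using topological_group by (simp add: topological_group_def)

lemma acts_fibre: "acts G (topspace X) \<phi>"
  using fibre_action group_action_imp_acts by (auto simp: continuous_action_def)

lemma acts_total: "acts G (topspace P) \<psi>"
  using principal_bundle group_action_imp_acts
  by (auto simp: principal_bundle_def continuous_action_def)

lemma fibre_closed [simp]: "g \<in> carrier G \<Longrightarrow> x \<in> topspace X \<Longrightarrow> \<phi> g x \<in> topspace X"
  and fibre_one [simp]: "x \<in> topspace X \<Longrightarrow> \<phi> \<one>\<^bsub>G\<^esub> x = x"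
  and fibre_mult: "g \<in> carrier G \<Longrightarrow> h \<in> carrier G \<Longrightarrow> x \<in> topspace X \<Longrightarrow>
    \<phi> (g \<otimes>\<^bsub>G\<^esub> h) x = \<phi> g (\<phi> h x)"
  using acts_fibre by (auto simp: acts_def)

lemma total_closed [simp]: "g \<in> carrier G \<Longrightarrow> e \<in> topspace P \<Longrightarrow> \<psi> g e \<in> topspace P"
  using acts_total by (auto simp: acts_def)

lemma acts_product: "acts G (topspace X \<times> topspace P) (diagonal_action \<phi> \<psi>)"
  using acts_fibre acts_total by (rule acts_diagonal)

lemma continuous_proj: "continuous_map P B \<tau>"
  using principal_bundle by (simp add: principal_bundle_def)

lemma proj_in [simp]: "e \<in> topspace P \<Longrightarrow> \<tau> e \<in> topspace B"
  using continuous_proj by (auto simp: continuous_map_def)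

section \<open>Local coordinates of the principal bundle, and its fibres as torsors\<close>

text \<open>The model for \<pi> is the group component of the inverse of a local trivialization.
  Freeness and transitivity on the fibres and the charts of the associated bundle are all derived
  from these clauses.\<close>

definition local_coordinate :: "'b set \<Rightarrow> ('p \<Rightarrow> 'g) \<Rightarrow> bool" where
  "local_coordinate U \<pi> \<longleftrightarrow> openin B U \<and>
     continuous_map (subtopology P {e \<in> topspace P. \<tau> e \<in> U}) TG \<pi> \<and>
     (\<forall>e\<in>topspace P. \<tau> e \<in> U \<longrightarrow> \<pi> e \<in> carrier G) \<and>
     (\<forall>e\<in>topspace P. \<tau> e \<in> U \<longrightarrow>
       (\<forall>g\<in>carrier G. \<tau> (\<psi> g e) = \<tau> e \<and> \<pi> (\<psi> g e) = g \<otimes>\<^bsub>G\<^esub> \<pi> e)) \<and>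
     (\<forall>e\<in>topspace P. \<forall>e'\<in>topspace P. \<tau> e \<in> U \<longrightarrow> \<tau> e' = \<tau> e \<longrightarrow> \<pi> e' = \<pi> e \<longrightarrow> e' = e)"

lemma local_coordinateD:
  assumes "local_coordinate U \<pi>"
  shows "openin B U" "continuous_map (subtopology P {e \<in> topspace P. \<tau> e \<in> U}) TG \<pi>"
    "\<And>e. e \<in> topspace P \<Longrightarrow> \<tau> e \<in> U \<Longrightarrow> \<pi> e \<in> carrier G"
    "\<And>e g. e \<in> topspace P \<Longrightarrow> \<tau> e \<in> U \<Longrightarrow> g \<in> carrier G \<Longrightarrow> \<tau> (\<psi> g e) = \<tau> e"
    "\<And>e g. e \<in> topspace P \<Longrightarrow> \<tau> e \<in> U \<Longrightarrow> g \<in> carrier G \<Longrightarrow> \<pi> (\<psi> g e) = g \<otimes>\<^bsub>G\<^esub> \<pi> e"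
    "\<And>e e'. e \<in> topspace P \<Longrightarrow> e' \<in> topspace P \<Longrightarrow> \<tau> e \<in> U \<Longrightarrow> \<tau> e' = \<tau> e \<Longrightarrow> \<pi> e' = \<pi> e
      \<Longrightarrow> e' = e"
  using assms by (simp_all add: local_coordinate_def)

text \<open>Both claims come from one trivialization \<Psi> around \<open>b\<close> with inverse
  \<Phi>. As \<Psi> lies over \<open>U\<close>, the first component of \<Phi> is \<tau>; the second
  one is the coordinate. The point over \<open>b\<close> is the image of \<open>b\<close> and the
  unit of the group.\<close>

lemma local_coordinate_exists:
  assumes "b \<in> topspace B"
  shows "\<exists>U \<pi>. b \<in> U \<and> local_coordinate U \<pi>" and "\<exists>e\<in>topspace P. \<tau> e = b"
proof -
  obtain U \<Psi> where U: "openin B U" "b \<in> U" and triv: "principal_trivialization G TG P \<psi> B \<tau> U \<Psi>"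
    using principal_bundle[unfolded principal_bundle_def] assms by (elim conjE ballE exE) auto
  let ?PU = "subtopology P {e \<in> topspace P. \<tau> e \<in> U}"
  let ?UG = "prod_topology (subtopology B U) TG"
  have "homeomorphic_map ?UG ?PU \<Psi>"
    using triv unfolding principal_trivialization_def by (elim conjE)
  then obtain \<Phi> where maps: "homeomorphic_maps ?UG ?PU \<Psi> \<Phi>"
    unfolding homeomorphic_map_maps by (elim exE)
  have \<Psi>: "continuous_map ?UG ?PU \<Psi>" and \<Phi>: "continuous_map ?PU ?UG \<Phi>"
    using maps by (simp_all add: homeomorphic_maps_def)
  have \<Phi>\<Psi>: "\<Phi> (\<Psi> (b, h)) = (b, h)" if "b \<in> topspace B" "b \<in> U" "h \<in> carrier G" for b h
    using maps that by (simp add: homeomorphic_maps_def topspace_TG)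
  have \<Psi>\<Phi>: "\<Psi> (\<Phi> e) = e" if "e \<in> topspace P" "\<tau> e \<in> U" for e
    using maps that by (simp add: homeomorphic_maps_def topspace_TG)
  have UB: "U \<subseteq> topspace B"
    using U(1) by (rule openin_subset)
  have \<tau>\<Psi>: "\<tau> (\<Psi> (b, h)) = b" if "b \<in> U" "h \<in> carrier G" for b h
    using triv that by (simp add: principal_trivialization_def)
  have \<Psi>_eq: "\<Psi> (b, g \<otimes>\<^bsub>G\<^esub> h) = \<psi> g (\<Psi> (b, h))"
    if "b \<in> U" "g \<in> carrier G" "h \<in> carrier G" for b g h
    using triv that by (simp add: principal_trivialization_def)
  define \<pi> where "\<pi> = (\<lambda>e. snd (\<Phi> e))"
  have \<pi>: "\<pi> e \<in> carrier G" "\<Psi> (\<tau> e, \<pi> e) = e" if "e \<in> topspace P" "\<tau> e \<in> U" for e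
  proof -
    have "e \<in> topspace ?PU"
      using that by simp
    then have "\<Phi> e \<in> topspace ?UG"
      using \<Phi> by (auto simp: continuous_map_def)
    then have 1: "fst (\<Phi> e) \<in> U" "\<pi> e \<in> carrier G"
      by (auto simp: \<pi>_def topspace_TG)
    have 2: "\<Psi> (fst (\<Phi> e), \<pi> e) = e"
      using \<Psi>\<Phi> that by (simp add: \<pi>_def)
    with \<tau>\<Psi>[OF 1] have "fst (\<Phi> e) = \<tau> e"
      by simp
    with 1 2 show "\<pi> e \<in> carrier G" "\<Psi> (\<tau> e, \<pi> e) = e"
      by simp_all
  qed
  have act: "\<tau> (\<psi> g e) = \<tau> e" "\<pi> (\<psi> g e) = g \<otimes>\<^bsub>G\<^esub> \<pi> e"
    if e: "e \<in> topspace P" "\<tau> e \<in> U" and g: "g \<in> carrier G" for e g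
  proof -
    have *: "\<psi> g e = \<Psi> (\<tau> e, g \<otimes>\<^bsub>G\<^esub> \<pi> e)"
      using \<pi>[OF e] \<Psi>_eq[OF e(2) g] by simp
    have g\<pi>: "g \<otimes>\<^bsub>G\<^esub> \<pi> e \<in> carrier G"
      using g \<pi>(1)[OF e] by simp
    show "\<tau> (\<psi> g e) = \<tau> e"
      unfolding * using \<tau>\<Psi>[OF e(2) g\<pi>] .
    have "\<tau> e \<in> topspace B"
      using UB e(2) by blast
    then show "\<pi> (\<psi> g e) = g \<otimes>\<^bsub>G\<^esub> \<pi> e"
      unfolding * \<pi>_def by (subst \<Phi>\<Psi>) (use e g\<pi> in \<open>simp_all add: \<pi>_def\<close>)
  qed
  have "local_coordinate U \<pi>"
    unfolding local_coordinate_def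
  proof (intro conjI ballI impI)
    show "continuous_map ?PU TG \<pi>"
      unfolding \<pi>_def using continuous_map_compose2[OF continuous_map_snd \<Phi>] .
    show "e' = e" if "e \<in> topspace P" "e' \<in> topspace P" "\<tau> e \<in> U" "\<tau> e' = \<tau> e" "\<pi> e' = \<pi> e" for e e'
    proof -
      have "e' = \<Psi> (\<tau> e', \<pi> e')"
        using \<pi>(2)[of e'] that by simp
      also have "\<dots> = e"
        unfolding that(4,5) using \<pi>(2) that by blast
      finally show ?thesis .
    qed
  qed (fact U(1) | rule \<pi>(1) act; assumption)+
  with U(2) show "\<exists>U \<pi>. b \<in> U \<and> local_coordinate U \<pi>"
    by blast
  have "(b, \<one>\<^bsub>G\<^esub>) \<in> topspace ?UG"
    using U assms by (simp add: topspace_TG)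
  then have "\<Psi> (b, \<one>\<^bsub>G\<^esub>) \<in> topspace ?PU"
    using continuous_map_image_subset_topspace[OF \<Psi>] by blast
  then have "\<Psi> (b, \<one>\<^bsub>G\<^esub>) \<in> topspace P" "\<tau> (\<Psi> (b, \<one>\<^bsub>G\<^esub>)) = b"
    using U \<tau>\<Psi> by simp_all
  then show "\<exists>e\<in>topspace P. \<tau> e = b"
    by blast
qed

text \<open>The definition of \<open>principal_bundle\<close> does not list invariance of \<tau>
  under the action; it follows from the equivariance of the trivializations.\<close>

lemma proj_invariant [simp]:
  assumes "e \<in> topspace P" "g \<in> carrier G"
  shows "\<tau> (\<psi> g e) = \<tau> e"
proof -
  obtain U \<pi> where "\<tau> e \<in> U" "local_coordinate U \<pi>"
    using local_coordinate_exists(1)[OF proj_in[OF assms(1)]] by blast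
  then show ?thesis
    using local_coordinateD(4) assms by simp
qed

text \<open>The coordinate turns the action on a fibre into left translation of the group, which is
  free and transitive. Together with \<open>total_transitive\<close> this makes the fibres of \<tau>
  torsors.\<close>

lemma total_free:
  assumes "e \<in> topspace P" "g \<in> carrier G" "\<psi> g e = e"
  shows "g = \<one>\<^bsub>G\<^esub>"
proof -
  obtain U \<pi> where U: "\<tau> e \<in> U" and \<pi>: "local_coordinate U \<pi>"
    using local_coordinate_exists(1)[OF proj_in[OF assms(1)]] by blast
  have "g \<otimes>\<^bsub>G\<^esub> \<pi> e = \<pi> e"
    using local_coordinateD(5)[OF \<pi> assms(1) U assms(2)] assms(3) by simp
  with local_coordinateD(3)[OF \<pi> assms(1) U] show ?thesis
    using assms(2) by simp
qed

lemma total_transitive: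
  assumes "e \<in> topspace P" "e' \<in> topspace P" "\<tau> e' = \<tau> e"
  shows "\<exists>g\<in>carrier G. \<psi> g e = e'"
proof -
  obtain U \<pi> where U: "\<tau> e \<in> U" and \<pi>: "local_coordinate U \<pi>"
    using local_coordinate_exists(1)[OF proj_in[OF assms(1)]] by blast
  define g where "g = \<pi> e' \<otimes>\<^bsub>G\<^esub> inv\<^bsub>G\<^esub> \<pi> e"
  have "\<pi> e \<in> carrier G" "\<pi> e' \<in> carrier G"
    using local_coordinateD(3)[OF \<pi>] U assms by simp_all
  then have g: "g \<in> carrier G" "g \<otimes>\<^bsub>G\<^esub> \<pi> e = \<pi> e'"
    by (simp_all add: g_def m_assoc)
  have "\<psi> g e = e'"
    using local_coordinateD(6)[OF \<pi> assms(2), of "\<psi> g e"] local_coordinateD(5)[OF \<pi> assms(1) U g(1)]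
      U assms g by simp
  with g(1) show ?thesis
    by blast
qed

section \<open>The associated bundle as an orbit space, and coordinates in its fibres\<close>

lemma quotient_Q: "quotient_map (prod_topology X P) E Q"
  unfolding assoc_space_def by (rule quotient_map_orbit)

lemma continuous_Q: "continuous_map (prod_topology X P) E Q"
  using quotient_Q by (rule quotient_imp_continuous_map)

lemma topspace_E: "topspace E = Q ` (topspace X \<times> topspace P)"
  using quotient_Q by (simp add: quotient_map_def)

lemma Q_in [simp]: "x \<in> topspace X \<Longrightarrow> e \<in> topspace P \<Longrightarrow> Q (x, e) \<in> topspace E"
  by (simp add: topspace_E)

lemma topspace_E_cases:
  assumes "c \<in> topspace E"
  obtains x e where "x \<in> topspace X" "e \<in> topspace P" "c = Q (x, e)"
  using assms by (auto simp: topspace_E)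

lemma Q_act [simp]:
  "x \<in> topspace X \<Longrightarrow> e \<in> topspace P \<Longrightarrow> g \<in> carrier G \<Longrightarrow> Q (\<phi> g x, \<psi> g e) = Q (x, e)"
  using orbit_acts[OF is_group acts_product, of "(x, e)" g] by (simp add: diagonal_action_def)

text \<open>Points of \<open>E\<close> are orbits, hence sets. An invariant function on
  \<open>X \<times> P\<close> therefore descends to \<open>E\<close> by taking the only value it has
  on the orbit; \<open>assoc_proj\<close> and the local charts of the fibre arise in this
  way.\<close>

lemma the_elem_image_Q:
  assumes "x \<in> topspace X" "e \<in> topspace P"
    and "\<And>g. g \<in> carrier G \<Longrightarrow> f (\<phi> g x, \<psi> g e) = f (x, e)"
  shows "the_elem (f ` Q (x, e)) = f (x, e)"
proof -
  have "f ` Q (x, e) = (\<lambda>g. f (\<phi> g x, \<psi> g e)) ` carrier G"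
    by (auto simp: orbit_def diagonal_action_def)
  also have "\<dots> = {f (x, e)}"
    using assms(3) one_closed by auto
  finally show ?thesis by simp
qed

lemma p_Q [simp]: "x \<in> topspace X \<Longrightarrow> e \<in> topspace P \<Longrightarrow> p (Q (x, e)) = \<tau> e"
  unfolding assoc_proj_def by (subst the_elem_image_Q) auto

lemma continuous_p: "continuous_map E B p"
proof (rule continuous_compose_quotient_map[OF quotient_Q])
  show "continuous_map (prod_topology X P) B (p \<circ> Q)"
    using continuous_map_compose2[OF continuous_proj continuous_map_snd]
    by (rule continuous_map_eq) auto
qed

text \<open>Meant for points \<open>c\<close> of \<open>E\<close> over \<open>\<tau> e\<close>:
  there uniqueness comes from \<open>Q_inject\<close> and existence from the lemma
  \<open>fibre_coord\<close>.\<close>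

definition fibre_coord :: "('x \<times> 'p) set \<Rightarrow> 'p \<Rightarrow> 'x" where
  "fibre_coord c e = (THE x. x \<in> topspace X \<and> Q (x, e) = c)"

text \<open>A group element that takes \<open>(x, e)\<close> to \<open>(y, e)\<close> fixes
  \<open>e\<close>, so it is the unit by freeness.\<close>

lemma Q_inject:
  assumes "x \<in> topspace X" "y \<in> topspace X" "e \<in> topspace P" "Q (x, e) = Q (y, e)"
  shows "x = y"
proof -
  obtain g where g: "g \<in> carrier G" "\<phi> g x = y" "\<psi> g e = e"
    using assms orbit_eq_acts_iff[OF is_group acts_product, of "(x, e)" "(y, e)"]
    by (auto simp: diagonal_action_def)
  then show ?thesis
    using total_free[OF assms(3) g(1,3)] assms(1) by simp
qed

lemma fibre_coord_Q [simp]: "x \<in> topspace X \<Longrightarrow> e \<in> topspace P \<Longrightarrow> fibre_coord (Q (x, e)) e = x"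
  unfolding fibre_coord_def by (rule the_equality) (simp_all add: Q_inject)

text \<open>By transitivity on the fibre of \<tau>, any representative \<open>(x, e')\<close> of
  \<open>c\<close> can be moved to one whose second component is \<open>e\<close>.\<close>

lemma fibre_coord:
  assumes "c \<in> topspace E" "e \<in> topspace P" "p c = \<tau> e"
  shows "fibre_coord c e \<in> topspace X" "Q (fibre_coord c e, e) = c"
proof -
  obtain x e' where x: "x \<in> topspace X" "e' \<in> topspace P" "c = Q (x, e')"
    using topspace_E_cases[OF assms(1)] .
  then obtain g where g: "g \<in> carrier G" "\<psi> g e' = e"
    using total_transitive[of e' e] assms by auto
  then have c: "c = Q (\<phi> g x, e)"
    using x(3) Q_act[OF x(1,2), of g] by simp
  then show "fibre_coord c e \<in> topspace X" "Q (fibre_coord c e, e) = c"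
    using x g assms(2) by simp_all
qed

lemma fibre_coord_act:
  assumes "c \<in> topspace E" "e \<in> topspace P" "p c = \<tau> e" "g \<in> carrier G"
  shows "fibre_coord c (\<psi> g e) = \<phi> g (fibre_coord c e)"
  using fibre_coord[OF assms(1-3)] assms fibre_coord_Q[of "\<phi> g (fibre_coord c e)" "\<psi> g e"]
  by simp

lemma continuous_act_fibre:
  assumes "continuous_map Z TG g" "continuous_map Z X f"
  shows "continuous_map Z X (\<lambda>z. \<phi> (g z) (f z))"
proof -
  have "continuous_map (prod_topology TG X) X (\<lambda>(g, x). \<phi> g x)"
    using fibre_action by (simp add: continuous_action_def)
  from continuous_map_compose2[OF this continuous_map_pairedI[OF assms]] show ?thesis
    by simp
qed

text \<open>
  Over a trivializing set with coordinate \<open>\<pi>\<close>, the map \<open>[x, e] \<mapsto> \<pi>(e)\<inverse> x\<close> is a continuous chart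
  \<open>\<kappa>\<close> of the fibre, and the coordinate of \<open>c\<close> with respect to \<open>e\<close> is \<open>\<pi>(e) \<kappa>(c)\<close>.
\<close>

lemma continuous_fibre_coord:
  "continuous_map
     (subtopology (prod_topology E P) {z. p (fst z) = \<tau> (snd z)}) X (\<lambda>z. fibre_coord (fst z) (snd z))"
  (is "continuous_map ?D X _")
proof (rule continuous_map_locally)
  fix z assume z: "z \<in> topspace ?D"
  then have "\<tau> (snd z) \<in> topspace B"
    by auto
  then obtain U \<pi> where U: "\<tau> (snd z) \<in> U" and coord: "local_coordinate U \<pi>"
    using local_coordinate_exists(1) by blast
  note U_open = local_coordinateD(1)[OF coord] and \<pi>_cont = local_coordinateD(2)[OF coord]
    and \<pi> = local_coordinateD(3,5)[OF coord]
  define \<kappa> where "\<kappa> = (\<lambda>c. the_elem ((\<lambda>(x, e). \<phi> (inv\<^bsub>G\<^esub> \<pi> e) x) ` c))"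
  have \<kappa>: "\<kappa> (Q (x, e)) = \<phi> (inv\<^bsub>G\<^esub> \<pi> e) x"
    if "x \<in> topspace X" "e \<in> topspace P" "\<tau> e \<in> U" for x e
    unfolding \<kappa>_def
  proof (subst the_elem_image_Q[OF that(1,2)])
    fix g assume g: "g \<in> carrier G"
    have [simp]: "\<pi> e \<in> carrier G" "\<pi> (\<psi> g e) = g \<otimes>\<^bsub>G\<^esub> \<pi> e"
      using \<pi> that g by auto
    have "\<phi> (inv\<^bsub>G\<^esub> (g \<otimes>\<^bsub>G\<^esub> \<pi> e)) (\<phi> g x) = \<phi> (inv\<^bsub>G\<^esub> (g \<otimes>\<^bsub>G\<^esub> \<pi> e) \<otimes>\<^bsub>G\<^esub> g) x"
      using that g by (simp add: fibre_mult)
    also have "inv\<^bsub>G\<^esub> (g \<otimes>\<^bsub>G\<^esub> \<pi> e) \<otimes>\<^bsub>G\<^esub> g = inv\<^bsub>G\<^esub> \<pi> e"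
      using g by (simp add: inv_mult_group m_assoc)
    finally show "(\<lambda>(x, e). \<phi> (inv\<^bsub>G\<^esub> \<pi> e) x) (\<phi> g x, \<psi> g e) = (\<lambda>(x, e). \<phi> (inv\<^bsub>G\<^esub> \<pi> e) x) (x, e)"
      by simp
  qed simp
  let ?EU = "{c \<in> topspace E. p c \<in> U}"
  let ?XPU = "{z \<in> topspace (prod_topology X P). Q z \<in> ?EU}"
  have EU: "openin E ?EU"
    using openin_continuous_map_preimage[OF continuous_p U_open] .
  have XPU: "snd z \<in> topspace P" "\<tau> (snd z) \<in> U" "fst z \<in> topspace X" if "z \<in> ?XPU" for z
    using that by (cases z; auto)+
  have \<pi>_XPU: "continuous_map (subtopology (prod_topology X P) ?XPU) TG (\<lambda>z. \<pi> (snd z))"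
  proof (rule continuous_map_compose2[OF \<pi>_cont], rule continuous_map_into_subtopology)
    show "snd \<in> topspace (subtopology (prod_topology X P) ?XPU) \<rightarrow> {e \<in> topspace P. \<tau> e \<in> U}"
      using XPU by auto
  qed (rule continuous_map_subtopology_snd)
  have inv: "continuous_map TG TG (\<lambda>g. inv\<^bsub>G\<^esub> g)"
    using topological_group by (simp add: topological_group_def)
  have \<kappa>_cont: "continuous_map (subtopology E ?EU) X \<kappa>"
  proof (rule continuous_compose_quotient_map)
    \<comment> \<open>A quotient map restricts to a quotient map over an open set, so continuity of
      \<kappa> may be checked on representatives, where the formula for \<kappa> is
      explicit.\<close>
    show "quotient_map (subtopology (prod_topology X P) ?XPU) (subtopology E ?EU) Q"
      using quotient_map_restriction[OF quotient_Q refl] EU by blast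
    have "continuous_map (subtopology (prod_topology X P) ?XPU) X (\<lambda>z. \<phi> (inv\<^bsub>G\<^esub> \<pi> (snd z)) (fst z))"
      by (intro continuous_act_fibre continuous_map_compose2[OF inv \<pi>_XPU] continuous_map_subtopology_fst)
    then show "continuous_map (subtopology (prod_topology X P) ?XPU) X (\<kappa> \<circ> Q)"
      by (rule continuous_map_eq) (auto simp: \<kappa>)
  qed
  let ?T = "topspace ?D \<inter> {z. p (fst z) \<in> U}"
  have fst_D: "continuous_map ?D E fst"
    by (rule continuous_map_subtopology_fst)
  have "?T = {z \<in> topspace ?D. fst z \<in> ?EU}"
    by auto
  then have "openin ?D ?T"
    using openin_continuous_map_preimage[OF fst_D EU] by simp
  moreover have "z \<in> ?T"
    using z U by simp
  moreover have "continuous_map (subtopology ?D ?T) X (\<lambda>z. fibre_coord (fst z) (snd z))"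
  proof -
    have "continuous_map (subtopology ?D ?T) X (\<lambda>z. \<phi> (\<pi> (snd z)) (\<kappa> (fst z)))"
    proof (rule continuous_act_fibre)
      show "continuous_map (subtopology ?D ?T) TG (\<lambda>z. \<pi> (snd z))"
      proof (rule continuous_map_compose2[OF \<pi>_cont], rule continuous_map_into_subtopology)
        show "continuous_map (subtopology ?D ?T) P snd"
          by (intro continuous_map_from_subtopology continuous_map_snd)
      qed auto
      show "continuous_map (subtopology ?D ?T) X (\<lambda>z. \<kappa> (fst z))"
      proof (rule continuous_map_compose2[OF \<kappa>_cont], rule continuous_map_into_subtopology)
        show "continuous_map (subtopology ?D ?T) E fst"
          by (intro continuous_map_from_subtopology continuous_map_fst)
      qed auto
    qed
    then show ?thesis
    proof (rule continuous_map_eq)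
      fix z assume "z \<in> topspace (subtopology ?D ?T)"
      then have z: "fst z \<in> topspace E" "snd z \<in> topspace P" "p (fst z) = \<tau> (snd z)" "\<tau> (snd z) \<in> U"
        by auto
      let ?x = "fibre_coord (fst z) (snd z)"
      have "\<kappa> (fst z) = \<phi> (inv\<^bsub>G\<^esub> \<pi> (snd z)) ?x"
        using \<kappa>[of ?x "snd z"] fibre_coord[OF z(1-3)] z by simp
      then show "\<phi> (\<pi> (snd z)) (\<kappa> (fst z)) = ?x"
        using fibre_coord(1)[OF z(1-3)] \<pi>(1)[OF z(2,4)] by (simp flip: fibre_mult)
    qed
  qed
  ultimately show "\<exists>T. openin ?D T \<and> z \<in> T \<and>
      continuous_map (subtopology ?D T) X (\<lambda>z. fibre_coord (fst z) (snd z))"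
    by blast
qed

lemma continuous_fibre_coord_compose:
  assumes "continuous_map Z E c" "continuous_map Z P e" "\<And>z. z \<in> topspace Z \<Longrightarrow> p (c z) = \<tau> (e z)"
  shows "continuous_map Z X (\<lambda>z. fibre_coord (c z) (e z))"
proof -
  have "continuous_map Z (subtopology (prod_topology E P) {z. p (fst z) = \<tau> (snd z)}) (\<lambda>z. (c z, e z))"
    using assms by (auto intro!: continuous_map_into_subtopology continuous_map_pairedI)
  from continuous_map_compose2[OF continuous_fibre_coord this] show ?thesis
    by simp
qed

end


section \<open>Fibre powers \<open>E\<^sup>r\<^sub>B\<close> and their coordinates in
  \<open>X\<^sup>r \<times> P\<close>\<close>

lemma topspace_power_space: "topspace (power_space r X) = PiE {1..r} (\<lambda>_. topspace X)"
  by (simp add: power_space_def)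

lemma continuous_map_into_power_space:
  assumes "\<And>i. i \<in> {1..r} \<Longrightarrow> continuous_map Z X (\<lambda>z. f z i)"
  shows "continuous_map Z (power_space r X) (\<lambda>z. \<lambda>i\<in>{1..r}. f z i)"
  unfolding power_space_def continuous_map_componentwise using assms by auto

lemma continuous_map_power_space_component:
  "i \<in> {1..r} \<Longrightarrow> continuous_map (power_space r X) X (\<lambda>x. x i)"
  unfolding power_space_def by (rule continuous_map_product_projection)

lemma topspace_fibre_power:
  "topspace (fibre_power r E p) = {c \<in> PiE {1..r} (\<lambda>_. topspace E).
     \<forall>i\<in>{1..r}. \<forall>j\<in>{1..r}. p (c i) = p (c j)}"
  by (auto simp: fibre_power_def topspace_power_space)

context associated_bundle
begin

abbreviation XP :: "nat \<Rightarrow> ((nat \<Rightarrow> 'x) \<times> 'p) topology" where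
  "XP r \<equiv> prod_topology (power_space r X) P"

abbreviation QR :: "nat \<Rightarrow> (nat \<Rightarrow> 'x) \<times> 'p \<Rightarrow> ((nat \<Rightarrow> 'x) \<times> 'p) set" where
  "QR r \<equiv> orbit G (diagonal_action (power_action r \<phi>) \<psi>)"

text \<open>
  The mutually inverse maps of the homeomorphism between \<open>X\<^sup>r \<times>\<^sub>G P\<close> and \<open>E\<^sup>r\<^sub>B\<close>, the first one
  before passing to orbits and the second one with a chosen representative \<open>e\<close> of the second factor.
\<close>

definition to_fibre_power :: "nat \<Rightarrow> (nat \<Rightarrow> 'x) \<times> 'p \<Rightarrow> nat \<Rightarrow> ('x \<times> 'p) set" where
  "to_fibre_power r z = (\<lambda>i\<in>{1..r}. Q (fst z i, snd z))"

definition fibre_coords :: "nat \<Rightarrow> (nat \<Rightarrow> ('x \<times> 'p) set) \<Rightarrow> 'p \<Rightarrow> nat \<Rightarrow> 'x" where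
  "fibre_coords r c e = (\<lambda>i\<in>{1..r}. fibre_coord (c i) e)"

lemma acts_power_product: "acts G (topspace (XP r)) (diagonal_action (power_action r \<phi>) \<psi>)"
  using acts_diagonal[OF acts_power[OF acts_fibre] acts_total] by (simp add: topspace_power_space)

lemma XP_component:
  "z \<in> topspace (XP r) \<Longrightarrow> i \<in> {1..r} \<Longrightarrow> fst z i \<in> topspace X"
  "z \<in> topspace (XP r) \<Longrightarrow> snd z \<in> topspace P"
  by (auto simp: topspace_power_space PiE_iff)

lemma fibre_power_component:
  assumes "c \<in> topspace (fibre_power r E p)" "i \<in> {1..r}"
  shows "c i \<in> topspace E" "p (c i) = p (c 1)"
proof -
  have c: "c \<in> PiE {1..r} (\<lambda>_. topspace E)" "\<forall>i\<in>{1..r}. \<forall>j\<in>{1..r}. p (c i) = p (c j)"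
    using assms(1) unfolding topspace_fibre_power by blast+
  then show "c i \<in> topspace E"
    using assms(2) by blast
  have "1 \<in> {1..r}"
    using assms(2) by simp
  with c(2) assms(2) show "p (c i) = p (c 1)"
    by blast
qed

lemma continuous_map_fibre_power_component:
  "i \<in> {1..r} \<Longrightarrow> continuous_map (fibre_power r E p) E (\<lambda>c. c i)"
  unfolding fibre_power_def
  by (intro continuous_map_from_subtopology continuous_map_power_space_component)

lemma continuous_to_fibre_power: "continuous_map (XP r) (fibre_power r E p) (to_fibre_power r)"
  unfolding fibre_power_def
proof (rule continuous_map_into_subtopology)
  show "continuous_map (XP r) (power_space r E) (to_fibre_power r)"
    unfolding to_fibre_power_def
  proof (intro continuous_map_into_power_space continuous_map_compose2[OF continuous_Q]
      continuous_map_pairedI continuous_map_snd)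
    show "continuous_map (XP r) X (\<lambda>z. fst z i)" if "i \<in> {1..r}" for i
      using continuous_map_compose2[OF continuous_map_power_space_component[OF that] continuous_map_fst] .
  qed
  show "to_fibre_power r \<in> topspace (XP r) \<rightarrow> {e. \<forall>i\<in>{1..r}. \<forall>j\<in>{1..r}. p (e i) = p (e j)}"
    using XP_component[of _ r] by (simp add: to_fibre_power_def)
qed

lemma to_fibre_power_invariant:
  assumes z: "z \<in> topspace (XP r)" and z': "z' \<in> topspace (XP r)" and "QR r z = QR r z'"
  shows "to_fibre_power r z = to_fibre_power r z'"
proof -
  obtain g where g: "g \<in> carrier G" "diagonal_action (power_action r \<phi>) \<psi> g z = z'"
    using assms orbit_eq_acts_iff[OF is_group acts_power_product z z'] by auto
  have z'_eq: "z' = ((\<lambda>i\<in>{1..r}. \<phi> g (fst z i)), \<psi> g (snd z))"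
    using g(2) by (auto simp: diagonal_action_def power_action_def split: prod.splits)
  show ?thesis
    unfolding to_fibre_power_def z'_eq using XP_component[OF z] g(1)
    by (intro restrict_ext) simp
qed

text \<open>All components of \<open>c\<close> lie over the same point of the base, so one
  \<open>e\<close> over that point serves as the second component of a representative for each of
  them.\<close>

lemma
  assumes c: "c \<in> topspace (fibre_power r E p)" and e: "e \<in> topspace P" "p (c 1) = \<tau> e"
  shows fibre_coords_in: "(fibre_coords r c e, e) \<in> topspace (XP r)"
    and fibre_coords_Q: "\<And>i. i \<in> {1..r} \<Longrightarrow> Q (fibre_coords r c e i, e) = c i"
    and fibre_coords_act: "\<And>g. g \<in> carrier G \<Longrightarrow>
      (fibre_coords r c (\<psi> g e), \<psi> g e) =
        diagonal_action (power_action r \<phi>) \<psi> g (fibre_coords r c e, e)"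
proof -
  have *: "c i \<in> topspace E" "p (c i) = \<tau> e" if "i \<in> {1..r}" for i
    using fibre_power_component[OF c that] e by simp_all
  show "(fibre_coords r c e, e) \<in> topspace (XP r)"
    using fibre_coord(1)[OF *(1) e(1) *(2)] e(1)
    by (simp add: topspace_power_space fibre_coords_def)
  show "Q (fibre_coords r c e i, e) = c i" if "i \<in> {1..r}" for i
    using fibre_coord(2)[OF *(1) e(1) *(2)] that by (simp add: fibre_coords_def)
  show "(fibre_coords r c (\<psi> g e), \<psi> g e) =
      diagonal_action (power_action r \<phi>) \<psi> g (fibre_coords r c e, e)" if "g \<in> carrier G" for g
    using fibre_coord_act[OF *(1) e(1) *(2) that]
    by (auto simp: diagonal_action_def power_action_def fibre_coords_def fun_eq_iff)
qed

lemma continuous_fibre_coords: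
  assumes "continuous_map Z (fibre_power r E p) c" "continuous_map Z P e"
    and "\<And>z. z \<in> topspace Z \<Longrightarrow> p (c z 1) = \<tau> (e z)"
  shows "continuous_map Z (XP r) (\<lambda>z. (fibre_coords r (c z) (e z), e z))"
  unfolding fibre_coords_def
proof (intro continuous_map_pairedI continuous_map_into_power_space assms(2)
    continuous_fibre_coord_compose)
  fix i assume i: "i \<in> {1..r}"
  show "continuous_map Z E (\<lambda>z. c z i)"
    using continuous_map_compose2[OF continuous_map_fibre_power_component[OF i] assms(1)] .
  fix z assume z: "z \<in> topspace Z"
  then have "c z \<in> topspace (fibre_power r E p)"
    using assms(1) by (auto simp: continuous_map_def)
  then show "p (c z i) = \<tau> (e z)"
    using fibre_power_component(2)[OF _ i] assms(3)[OF z] by simp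
qed


section \<open>Transfer of sections\<close>

lemma path_in_fibre:
  assumes "\<gamma> \<in> topspace (fibre_paths E p)" "u \<in> {0..1}" "v \<in> {0..1}"
  shows "p (\<gamma> u) = p (\<gamma> v)"
  using assms unfolding fibre_paths_def topspace_subtopology by blast

text \<open>For \<open>z = (x, e)\<close> the given section yields a path in the fibre over
  \<open>\<tau> e\<close> that passes through \<open>[x\<^sub>i, e]\<close> at time
  \<open>t i\<close>. Its coordinate with respect to \<open>e\<close>, precomposed with \<theta>, is
  a path in \<open>X\<close> that passes through \<open>x\<^sub>i\<close> at time
  \<open>s i\<close>.\<close>

lemma section_over_weak:
  assumes r: "1 \<le> r"
    and sec: "section_over (fibre_paths E p) (fibre_power r E p) (eval_at r t) U"
    and \<theta>: "continuous_map (top_of_set {0..1}) (top_of_set {0..1}) \<theta>"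
    and s: "\<And>i. i \<in> {1..r} \<Longrightarrow> s i \<in> {0..1} \<and> \<theta> (s i) = t i"
  shows "section_over (prod_topology (path_space X) P) (XP r) (\<lambda>(\<gamma>, e). (eval_at r s \<gamma>, e))
    {z \<in> topspace (XP r). to_fibre_power r z \<in> U}"
    (is "section_over _ _ _ ?S")
proof -
  let ?I = "top_of_set {0..1::real}"
  let ?F = "fibre_power r E p"
  let ?Z = "subtopology (XP r) ?S"
  obtain \<sigma> where \<sigma>: "continuous_map (subtopology ?F U) (fibre_paths E p) \<sigma>"
      "\<And>c. c \<in> topspace ?F \<inter> U \<Longrightarrow> eval_at r t (\<sigma> c) = c"
    using sec unfolding section_over_def by blast
  have \<theta>_in: "\<theta> u \<in> {0..1}" if "u \<in> {0..1}" for u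
    using \<theta> that by (auto simp: continuous_map_def)
  have "continuous_map ?Z (subtopology ?F U) (to_fibre_power r)"
    by (intro continuous_map_into_subtopology continuous_map_from_subtopology
        continuous_to_fibre_power) auto
  from continuous_map_compose2[OF \<sigma>(1) this]
  have \<sigma>F: "continuous_map ?Z (fibre_paths E p) (\<lambda>z. \<sigma> (to_fibre_power r z))" .
  have \<sigma>t: "\<sigma> (to_fibre_power r z) (t i) = Q (fst z i, snd z)"
    if z: "z \<in> topspace ?Z" and i: "i \<in> {1..r}" for z i
  proof -
    have "to_fibre_power r z \<in> topspace ?F \<inter> U"
      using z continuous_to_fibre_power by (auto simp: continuous_map_def)
    from fun_cong[OF \<sigma>(2)[OF this], of i] show ?thesis
      using i by (simp add: eval_at_def to_fibre_power_def)
  qed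
  \<comment> \<open>The path in \<open>X\<close> in uncurried form: its joint continuity is proved
    first, and \<open>path_space_curry\<close> then makes it a continuous map into the path
    space.\<close>
  define h where "h = (\<lambda>z u. fibre_coord (\<sigma> (to_fibre_power r z) (\<theta> u)) (snd z))"
  have "continuous_map (prod_topology ?Z ?I) X
      (\<lambda>y. fibre_coord (\<sigma> (to_fibre_power r (fst y)) (\<theta> (snd y))) (snd (fst y)))"
  proof (rule continuous_fibre_coord_compose)
    have "continuous_map (prod_topology ?Z ?I) (prod_topology (path_space E) ?I)
        (\<lambda>y. (\<sigma> (to_fibre_power r (fst y)), \<theta> (snd y)))"
      using \<sigma>F \<theta> unfolding fibre_paths_def
      by (intro continuous_map_pairedI continuous_map_compose2[OF _ continuous_map_fst]
          continuous_map_compose2[OF _ continuous_map_snd]) (auto dest: continuous_map_into_fulltopology)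
    from continuous_map_compose2[OF path_space_eval this]
    show "continuous_map (prod_topology ?Z ?I) E (\<lambda>y. \<sigma> (to_fibre_power r (fst y)) (\<theta> (snd y)))"
      by simp
    show "continuous_map (prod_topology ?Z ?I) P (\<lambda>y. snd (fst y))"
      by (rule continuous_map_compose2[OF _ continuous_map_fst])
        (rule continuous_map_subtopology_snd)
    fix y assume y: "y \<in> topspace (prod_topology ?Z ?I)"
    then have z: "fst y \<in> topspace ?Z" and u: "snd y \<in> {0..1}"
      by auto
    have r1: "1 \<in> {1..r}"
      using r by simp
    have "\<sigma> (to_fibre_power r (fst y)) \<in> topspace (fibre_paths E p)"
      using z \<sigma>F by (auto simp: continuous_map_def)
    \<comment> \<open>The path stays in one fibre, which is identified at time \<open>t 1\<close>,
      where its value is known.\<close>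
    then have "p (\<sigma> (to_fibre_power r (fst y)) (\<theta> (snd y))) = p (\<sigma> (to_fibre_power r (fst y)) (t 1))"
      using s[OF r1] u by (intro path_in_fibre) (metis \<theta>_in)+
    also have "\<dots> = p (Q (fst (fst y) 1, snd (fst y)))"
      using \<sigma>t[OF z r1] by simp
    also have "\<dots> = \<tau> (snd (fst y))"
      using z XP_component[of "fst y" r] r1 by (intro p_Q) auto
    finally show "p (\<sigma> (to_fibre_power r (fst y)) (\<theta> (snd y))) = \<tau> (snd (fst y))" .
  qed
  then have "continuous_map (prod_topology ?Z ?I) X (\<lambda>(z, u). h z u)"
    by (simp add: h_def case_prod_unfold)
  from path_space_curry[OF this] have curry: "continuous_map ?Z (path_space X) (\<lambda>z. \<lambda>u\<in>{0..1}. h z u)" .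
  show ?thesis
    unfolding section_over_def
  proof (intro exI conjI ballI)
    show "continuous_map ?Z (prod_topology (path_space X) P) (\<lambda>z. (\<lambda>u\<in>{0..1}. h z u, snd z))"
      using curry continuous_map_subtopology_snd by (rule continuous_map_pairedI)
    fix z assume "z \<in> topspace (XP r) \<inter> ?S"
    then have z: "z \<in> topspace ?Z" and z': "z \<in> topspace (XP r)"
      by auto
    have "eval_at r s (\<lambda>u\<in>{0..1}. h z u) = fst z"
    proof (rule extensionalityI)
      show "fst z \<in> extensional {1..r}"
        using z' by (auto simp: topspace_power_space PiE_iff)
      fix i assume i: "i \<in> {1..r}"
      have "h z (s i) = fst z i"
        using s[OF i] \<sigma>t[OF z i] XP_component[OF z'] i by (simp add: h_def)
      then show "eval_at r s (\<lambda>u\<in>{0..1}. h z u) i = fst z i"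
        using s[OF i] i by (simp add: eval_at_def)
    qed (simp add: eval_at_def)
    then show "(\<lambda>(\<gamma>, e). (eval_at r s \<gamma>, e)) (\<lambda>u\<in>{0..1}. h z u, snd z) = z"
      by simp
  qed
qed

text \<open>The reverse passage. The map \<open>e\<close> selects continuously a point of
  \<open>P\<close> over the base point of each tuple in \<open>W\<close>, so the tuple lifts to
  \<open>X\<^sup>r \<times> P\<close>, where the given section provides a path in \<open>X\<close>.
  Pairing this path with the constant \<open>e c\<close> returns it to one fibre of
  \<open>E\<close>.\<close>

lemma section_over_fibre_power:
  assumes r: "1 \<le> r"
    and sec: "section_over (prod_topology (path_space X) P) (XP r) (\<lambda>(\<gamma>, e). (eval_at r s \<gamma>, e)) S"
    and \<theta>: "continuous_map (top_of_set {0..1}) (top_of_set {0..1}) \<theta>"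
    and t: "\<And>i. i \<in> {1..r} \<Longrightarrow> t i \<in> {0..1} \<and> \<theta> (t i) = s i"
    and e: "continuous_map (subtopology (fibre_power r E p) W) P e"
      "\<And>c. c \<in> topspace (fibre_power r E p) \<inter> W \<Longrightarrow> p (c 1) = \<tau> (e c)"
    and S: "\<And>c. c \<in> topspace (fibre_power r E p) \<inter> W \<Longrightarrow> (fibre_coords r c (e c), e c) \<in> S"
  shows "section_over (fibre_paths E p) (fibre_power r E p) (eval_at r t) W"
proof -
  let ?I = "top_of_set {0..1::real}"
  let ?F = "fibre_power r E p"
  let ?Z = "subtopology ?F W"
  let ?z = "\<lambda>c. (fibre_coords r c (e c), e c)"
  obtain \<sigma> where \<sigma>: "continuous_map (subtopology (XP r) S) (prod_topology (path_space X) P) \<sigma>"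
      "\<And>z. z \<in> topspace (XP r) \<inter> S \<Longrightarrow> (\<lambda>(\<gamma>, e). (eval_at r s \<gamma>, e)) (\<sigma> z) = z"
    using sec unfolding section_over_def by blast
  have \<theta>_in: "\<theta> u \<in> {0..1}" if "u \<in> {0..1}" for u
    using \<theta> that by (auto simp: continuous_map_def)
  have eP: "e c \<in> topspace P" if "c \<in> topspace ?F \<inter> W" for c
    using e(1) that by (auto simp: continuous_map_def)
  have "continuous_map ?Z (XP r) ?z"
    using e(2) by (intro continuous_fibre_coords e(1))
      (auto intro: continuous_map_from_subtopology)
  then have "continuous_map ?Z (subtopology (XP r) S) ?z"
    using S by (intro continuous_map_into_subtopology) auto
  from continuous_map_compose2[OF continuous_map_fst continuous_map_compose2[OF \<sigma>(1) this]]
  have path: "continuous_map ?Z (path_space X) (\<lambda>c. fst (\<sigma> (?z c)))" .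
  have \<sigma>s: "fst (\<sigma> (?z c)) (s i) = fibre_coords r c (e c) i"
    if c: "c \<in> topspace ?F \<inter> W" and i: "i \<in> {1..r}" for c i
  proof -
    have "?z c \<in> topspace (XP r) \<inter> S"
      using fibre_coords_in[of c r "e c", OF _ eP[OF c] e(2)[OF c]] S[OF c] c by blast
    from \<sigma>(2)[OF this] have "eval_at r s (fst (\<sigma> (?z c))) = fibre_coords r c (e c)"
      by (simp add: case_prod_beta)
    from fun_cong[OF this, of i] show ?thesis
      using i by (simp add: eval_at_def)
  qed
  define h where "h = (\<lambda>c u. Q (fst (\<sigma> (?z c)) (\<theta> u), e c))"
  have "continuous_map (prod_topology ?Z ?I) E
      (\<lambda>y. Q (fst (\<sigma> (?z (fst y))) (\<theta> (snd y)), e (fst y)))"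
  proof (intro continuous_map_compose2[OF continuous_Q] continuous_map_pairedI)
    have "continuous_map (prod_topology ?Z ?I) (prod_topology (path_space X) ?I)
        (\<lambda>y. (fst (\<sigma> (?z (fst y))), \<theta> (snd y)))"
      using path \<theta>
      by (intro continuous_map_pairedI continuous_map_compose2[OF path continuous_map_fst]
          continuous_map_compose2[OF \<theta> continuous_map_snd])
    from continuous_map_compose2[OF path_space_eval this]
    show "continuous_map (prod_topology ?Z ?I) X (\<lambda>y. fst (\<sigma> (?z (fst y))) (\<theta> (snd y)))"
      by simp
    show "continuous_map (prod_topology ?Z ?I) P (\<lambda>y. e (fst y))"
      using continuous_map_compose2[OF e(1) continuous_map_fst] .
  qed
  then have "continuous_map (prod_topology ?Z ?I) E (\<lambda>(c, u). h c u)"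
    by (simp add: h_def case_prod_unfold)
  from path_space_curry[OF this] have curry: "continuous_map ?Z (path_space E) (\<lambda>c. \<lambda>u\<in>{0..1}. h c u)" .
  have p_h: "p (h c u) = \<tau> (e c)" if c: "c \<in> topspace ?F \<inter> W" and u: "u \<in> {0..1}" for c u
  proof -
    have "c \<in> topspace ?Z"
      using c by simp
    then have "fst (\<sigma> (?z c)) \<in> topspace (path_space X)"
      using path unfolding continuous_map_def by blast
    then have "fst (\<sigma> (?z c)) (\<theta> u) \<in> topspace X"
      using \<theta>_in[OF u] by (auto simp: topspace_path_space pathin_def continuous_map_def)
    then show ?thesis
      unfolding h_def using eP[OF c] by (rule p_Q)
  qed
  show ?thesis
    unfolding section_over_def
  proof (intro exI conjI ballI)
    show "continuous_map ?Z (fibre_paths E p) (\<lambda>c. \<lambda>u\<in>{0..1}. h c u)"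
      unfolding fibre_paths_def
    proof (rule continuous_map_into_subtopology[OF curry])
      show "(\<lambda>c. \<lambda>u\<in>{0..1}. h c u) \<in> topspace ?Z \<rightarrow> {\<gamma>. \<forall>a\<in>{0..1}. \<forall>b\<in>{0..1}. p (\<gamma> a) = p (\<gamma> b)}"
        using p_h by simp
    qed
    fix c assume c: "c \<in> topspace ?F \<inter> W"
    show "eval_at r t (\<lambda>u\<in>{0..1}. h c u) = c"
    proof (rule extensionalityI)
      show "c \<in> extensional {1..r}"
        using c unfolding topspace_fibre_power PiE_def by blast
      fix i assume i: "i \<in> {1..r}"
      have "h c (t i) = Q (fibre_coords r c (e c) i, e c)"
        using t[OF i] \<sigma>s[OF c i] by (simp add: h_def)
      also have "\<dots> = c i"
        using fibre_coords_Q[of c r "e c", OF _ eP[OF c] e(2)[OF c] i] c by simp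
      finally show "eval_at r t (\<lambda>u\<in>{0..1}. h c u) i = c i"
        using t[OF i] i by (simp add: eval_at_def)
    qed (simp add: eval_at_def)
  qed
qed

end


section \<open>The two inequalities\<close>

text \<open>A finite infimum excludes the empty set, whose infimum is \<infinity>, and a nonempty
  set of extended naturals has a least element.\<close>

lemma Inf_enat_Collect_attained:
  assumes "Inf {enat k |k. R k} = enat n"
  shows "R n"
proof -
  let ?A = "{enat k |k. R k}"
  have "?A \<noteq> {}"
    using assms unfolding Inf_enat_def by (auto split: if_splits)
  then obtain x where "x \<in> ?A"
    by blast
  from LeastI[of "\<lambda>x. x \<in> ?A", OF this] \<open>?A \<noteq> {}\<close> have "Inf ?A \<in> ?A"
    unfolding Inf_enat_def by simp
  then show ?thesis
    using assms by auto
qed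

context associated_bundle
begin

section \<open>The lower bound\<close>

text \<open>Every \<open>k\<close> admissible for \<open>param_TC\<close> is admissible for
  \<open>weak_TC\<close>: a cover of \<open>E\<^sup>r\<^sub>B\<close> is pulled back to
  \<open>X\<^sup>r \<times> P\<close> and pushed down to the orbit space with the number of sets
  unchanged.\<close>

lemma weak_TC_le_param_TC:
  assumes r: "1 \<le> r" and "inj_on s {1..r}" "s ` {1..r} \<subseteq> {0..1}" "t ` {1..r} \<subseteq> {0..1}"
  shows "weak_TC r s G X \<phi> P \<psi> \<le> param_TC r t E p"
  unfolding weak_TC_def secat_wrt_def param_TC_def secat_def
proof (rule Inf_superset_mono, safe)
  fix k and U :: "nat \<Rightarrow> (nat \<Rightarrow> ('x \<times> 'p) set) set"
  let ?F = "fibre_power r E p"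
  assume U: "\<forall>i\<le>k. openin ?F (U i) \<and> section_over (fibre_paths E p) ?F (eval_at r t) (U i)"
    and cover: "topspace ?F \<subseteq> (\<Union>i\<le>k. U i)"
  obtain \<theta> where \<theta>: "continuous_map (top_of_set {0..1}) (top_of_set {0..1}) \<theta>"
      "\<And>i. i \<in> {1..r} \<Longrightarrow> \<theta> (s i) = t i"
    using unit_interval_reparametrization[OF assms(2) _ assms(4)] by blast
  let ?S = "\<lambda>i. {z \<in> topspace (XP r). to_fibre_power r z \<in> U i}"
  \<comment> \<open>As \<open>to_fibre_power\<close> is constant on orbits, \<open>?S i\<close> is
    saturated. Hence it is the full preimage of \<open>V i\<close>, and \<open>V i\<close> is open
    in the orbit space.\<close>
  define V where "V = (\<lambda>i. QR r ` ?S i)"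
  have preimage: "{z \<in> topspace (XP r). QR r z \<in> V i} = ?S i" for i
  proof (intro subset_antisym subsetI)
    fix z assume "z \<in> {z \<in> topspace (XP r). QR r z \<in> V i}"
    then obtain z' where "z \<in> topspace (XP r)" "z' \<in> ?S i" "QR r z = QR r z'"
      by (auto simp only: V_def)
    then show "z \<in> ?S i"
      using to_fibre_power_invariant[of z r z'] by simp
  qed (auto simp: V_def)
  have "openin (assoc_space G (power_space r X) (power_action r \<phi>) P \<psi>) (V i) \<and>
      section_over (prod_topology (path_space X) P) (XP r) (\<lambda>(\<gamma>, e). (eval_at r s \<gamma>, e))
        {z \<in> topspace (XP r). QR r z \<in> V i}" if i: "i \<le> k" for i
  proof
    have "openin (XP r) (?S i)"
      using openin_continuous_map_preimage[OF continuous_to_fibre_power] U i by blast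
    then show "openin (assoc_space G (power_space r X) (power_action r \<phi>) P \<psi>) (V i)"
      unfolding assoc_space_def openin_orbit_space preimage by (auto simp: V_def orbits_def)
    show "section_over (prod_topology (path_space X) P) (XP r) (\<lambda>(\<gamma>, e). (eval_at r s \<gamma>, e))
        {z \<in> topspace (XP r). QR r z \<in> V i}"
      unfolding preimage
    proof (rule section_over_weak[OF r _ \<theta>(1)])
      show "section_over (fibre_paths E p) ?F (eval_at r t) (U i)"
        using U i by blast
      show "s m \<in> {0..1} \<and> \<theta> (s m) = t m" if "m \<in> {1..r}" for m
        using assms(3) \<theta>(2) that by blast
    qed
  qed
  moreover have "QR r ` topspace (XP r) \<subseteq> (\<Union>i\<le>k. V i)"
  proof (rule image_subsetI)
    fix z assume z: "z \<in> topspace (XP r)"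
    then have "to_fibre_power r z \<in> topspace ?F"
      using continuous_to_fibre_power unfolding continuous_map_def by blast
    then obtain i where "i \<le> k" "to_fibre_power r z \<in> U i"
      using cover by blast
    with z show "QR r z \<in> (\<Union>i\<le>k. V i)"
      unfolding V_def by blast
  qed
  ultimately show "\<exists>k'. enat k = enat k' \<and> (\<exists>U. (\<forall>i\<le>k'.
      openin (assoc_space G (power_space r X) (power_action r \<phi>) P \<psi>) (U i) \<and>
      section_over (prod_topology (path_space X) P) (XP r) (\<lambda>(\<gamma>, e). (eval_at r s \<gamma>, e))
        {b \<in> topspace (XP r). QR r b \<in> U i}) \<and> QR r ` topspace (XP r) \<subseteq> (\<Union>i\<le>k'. U i))"
    by blast
qed

section \<open>The upper bound\<close>

text \<open>A trivialization carries the unit section of \<open>U \<times> G\<close> to a section of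
  \<tau>.\<close>

lemma trivial_G_bundle_over_section:
  assumes "openin B U" "trivial_G_bundle_over G TG X \<phi> P \<psi> B \<tau> U"
  obtains \<sigma> where "continuous_map (subtopology B U) P \<sigma>" "\<And>b. b \<in> U \<Longrightarrow> \<tau> (\<sigma> b) = b"
proof -
  obtain \<Psi> where \<Psi>: "principal_trivialization G TG P \<psi> B \<tau> U \<Psi>"
    using assms(2) unfolding trivial_G_bundle_over_def by blast
  let ?PU = "subtopology P {e \<in> topspace P. \<tau> e \<in> U}"
  have cont: "continuous_map (prod_topology (subtopology B U) TG) ?PU \<Psi>"
    using \<Psi> unfolding principal_trivialization_def by (blast intro: homeomorphic_imp_continuous_map)
  have "continuous_map (subtopology B U) (prod_topology (subtopology B U) TG) (\<lambda>b. (b, \<one>\<^bsub>G\<^esub>))"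
    by (intro continuous_map_pairedI) (auto simp: topspace_TG)
  from continuous_map_into_fulltopology[OF continuous_map_compose2[OF cont this]]
  have "continuous_map (subtopology B U) P (\<lambda>b. \<Psi> (b, \<one>\<^bsub>G\<^esub>))" .
  moreover have "\<tau> (\<Psi> (b, \<one>\<^bsub>G\<^esub>)) = b" if "b \<in> U" for b
    using \<Psi> that by (simp add: principal_trivialization_def)
  ultimately show thesis
    by (rule that)
qed

lemma param_TC_le:
  assumes r: "1 \<le> r" and t: "inj_on t {1..r}" "t ` {1..r} \<subseteq> {0..1}" and s: "s ` {1..r} \<subseteq> {0..1}"
    and normal: "normal_space B"
  shows "param_TC r t E p \<le> G_cat G TG X \<phi> P \<psi> B \<tau> + weak_TC r s G X \<phi> P \<psi>"
proof (cases "G_cat G TG X \<phi> P \<psi> B \<tau>"; cases "weak_TC r s G X \<phi> P \<psi>")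
  fix k l assume k: "G_cat G TG X \<phi> P \<psi> B \<tau> = enat k" and l: "weak_TC r s G X \<phi> P \<psi> = enat l"
  let ?F = "fibre_power r E p"
  let ?XPG = "assoc_space G (power_space r X) (power_action r \<phi>) P \<psi>"
  obtain U :: "nat \<Rightarrow> 'b set"
    where U: "\<And>i. i \<le> k \<Longrightarrow> openin B (U i)"
      "\<And>i. i \<le> k \<Longrightarrow> trivial_G_bundle_over G TG X \<phi> P \<psi> B \<tau> (U i)"
      and U_cover: "topspace B = (\<Union>i\<le>k. U i)"
    using Inf_enat_Collect_attained[OF k[unfolded G_cat_def]] by blast
  obtain V :: "nat \<Rightarrow> ((nat \<Rightarrow> 'x) \<times> 'p) set set"
    where V: "\<And>j. j \<le> l \<Longrightarrow> openin ?XPG (V j)"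
      "\<And>j. j \<le> l \<Longrightarrow> section_over (prod_topology (path_space X) P) (XP r)
        (\<lambda>(\<gamma>, e). (eval_at r s \<gamma>, e)) {z \<in> topspace (XP r). QR r z \<in> V j}"
      and V_cover: "QR r ` topspace (XP r) \<subseteq> (\<Union>j\<le>l. V j)"
    using Inf_enat_Collect_attained[OF l[unfolded weak_TC_def secat_wrt_def]] by blast
  \<comment> \<open>The times are exchanged in the direction opposite to that of the lower
    bound.\<close>
  obtain \<theta> where \<theta>: "continuous_map (top_of_set {0..1}) (top_of_set {0..1}) \<theta>"
      "\<And>i. i \<in> {1..r} \<Longrightarrow> \<theta> (t i) = s i"
    using unit_interval_reparametrization[OF t(1) _ s] by blast
  have "\<forall>i. \<exists>\<sigma>. i \<le> k \<longrightarrow>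
      continuous_map (subtopology B (U i)) P \<sigma> \<and> (\<forall>b\<in>U i. \<tau> (\<sigma> b) = b)"
    using trivial_G_bundle_over_section U by metis
  then obtain \<sigma> where \<sigma>: "\<And>i. i \<le> k \<Longrightarrow> continuous_map (subtopology B (U i)) P (\<sigma> i)"
      "\<And>i b. i \<le> k \<Longrightarrow> b \<in> U i \<Longrightarrow> \<tau> (\<sigma> i b) = b"
    by metis
  have "topspace B \<subseteq> (\<Union>i<Suc k. U i)"
    using U_cover by (simp add: lessThan_Suc_atMost)
  from normal_space_bump_functions[OF normal closedin_topspace _ this] U(1)
  obtain f :: "nat \<Rightarrow> 'b \<Rightarrow> real"
    where f: "\<And>i. i < Suc k \<Longrightarrow> continuous_map B euclideanreal (f i)"
      "\<And>i b. i < Suc k \<Longrightarrow> b \<in> topspace B - U i \<Longrightarrow> f i b = 0"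
      "\<And>b. b \<in> topspace B \<Longrightarrow> \<exists>i<Suc k. f i b = 1"
    by (metis less_Suc_eq_le)
  \<comment> \<open>Thresholds increasing from \<open>a 0 = 0\<close> to
    \<open>a (Suc l) = 1\<close>. Being nonnegative, they confine \<open>a j < f i b\<close> to
    \<open>U i\<close>; being below 1 for \<open>j \<le> l\<close>, they are exceeded at every point
    by some \<open>f i\<close>.\<close>
  define a where "a = (\<lambda>j. real j / real (Suc l))"
  have a: "0 \<le> a j" "a j < a (Suc j)" for j
    by (simp_all add: a_def divide_strict_right_mono)
  have a_less: "a j < 1" if "j \<le> l" for j
    using that by (simp add: a_def)
  have a_mono: "a j \<le> a j'" if "j \<le> j'" for j j'
    using that by (simp add: a_def divide_right_mono)
  define D where "D = (\<lambda>j i. {b \<in> topspace B. a j < f i b \<and> (\<forall>i'<i. f i' b < a (Suc j))})"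
  \<comment> \<open>Each \<open>D j\<close> covers \<open>B\<close>. If \<open>i < i'\<close> and \<open>i + j = i' + j'\<close>, then \<open>f i\<close> exceeds \<open>a j\<close> on \<open>D j i\<close>
    and is below \<open>a (Suc j') \<le> a j\<close> on \<open>D j' i'\<close>, so these sets are disjoint.\<close>
  have D_sub: "D j i \<subseteq> U i" if "i \<le> k" for j i
  proof
    fix b assume "b \<in> D j i"
    then have "b \<in> topspace B" "f i b > 0"
      using a(1)[of j] by (auto simp: D_def)
    then show "b \<in> U i"
      using f(2)[of i b] that by auto
  qed
  have D_open: "openin B (D j i)" if "i \<le> k" for j i
  proof -
    have lt: "openin B {b \<in> topspace B. f i' b < a (Suc j)}" if "i' < i" for i'
      using openin_continuous_map_preimage[OF f(1), of i' "{..<a (Suc j)}"] that \<open>i \<le> k\<close> by simp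
    have "openin B {b \<in> topspace B. a j < f i b}"
      using openin_continuous_map_preimage[OF f(1), of i "{a j<..}"] that by simp
    moreover have "openin B (topspace B \<inter> (\<Inter>i'<i. {b \<in> topspace B. f i' b < a (Suc j)}))"
      using lt by (cases "i = 0") (auto intro!: openin_Int openin_Inter)
    moreover have "D j i = {b \<in> topspace B. a j < f i b} \<inter>
        (topspace B \<inter> (\<Inter>i'<i. {b \<in> topspace B. f i' b < a (Suc j)}))"
      by (auto simp: D_def)
    ultimately show ?thesis
      by (simp add: openin_Int)
  qed
  have D_cover: "\<exists>i\<le>k. b \<in> D j i" if b: "b \<in> topspace B" and j: "j \<le> l" for b j
  proof -
    \<comment> \<open>All earlier functions are at most \<open>a j\<close> at \<open>b\<close>,
      hence strictly below \<open>a (Suc j)\<close>. This slack lets \<open>D j i\<close> be given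
      by strict inequalities, so that it is open.\<close>
    define i where "i = (LEAST i. a j < f i b)"
    obtain i0 where i0: "i0 < Suc k" "f i0 b = 1"
      using f(3)[OF b] by blast
    then have "a j < f i0 b"
      using a_less[OF j] by simp
    then have i: "a j < f i b" "i \<le> i0"
      unfolding i_def by (rule LeastI, rule Least_le)
    have "f i' b < a (Suc j)" if "i' < i" for i'
      using not_less_Least[OF that[unfolded i_def]] a(2)[of j] by simp
    then show ?thesis
      using i i0 b by (intro exI[of _ i]) (auto simp: D_def)
  qed
  \<comment> \<open>The base point of a tuple is read off from its first component, and
    \<open>\<sigma> i\<close> chooses the point of \<open>P\<close> above it.\<close>
  let ?e = "\<lambda>i c. \<sigma> i (p (c 1))"
  let ?z = "\<lambda>i c. (fibre_coords r c (?e i c), ?e i c)"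
  define W where "W = (\<lambda>j i. {c \<in> topspace ?F. p (c 1) \<in> D j i \<and> QR r (?z i c) \<in> V j})"
  have r1: "1 \<in> {1..r}"
    using r by simp
  have pF: "continuous_map ?F B (\<lambda>c. p (c 1))"
    using continuous_map_compose2[OF continuous_p continuous_map_fibre_power_component[OF r1]] .
  have e: "continuous_map (subtopology ?F A) P (?e i)" if "i \<le> k" "A \<subseteq> {c. p (c 1) \<in> U i}" for i A
    using that pF
    by (intro continuous_map_compose2[OF \<sigma>(1)] continuous_map_into_subtopology
        continuous_map_from_subtopology) auto
  have W_open: "openin ?F (W j i)" if i: "i \<le> k" and j: "j \<le> l" for j i
  proof -
    \<comment> \<open>The lift \<open>?z i\<close> is known to be continuous only over
      \<open>U i\<close>. So \<open>W j i\<close> is first shown to be open in \<open>?A\<close>,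
      which is itself open.\<close>
    let ?A = "{c \<in> topspace ?F. p (c 1) \<in> D j i}"
    have A: "openin ?F ?A"
      using openin_continuous_map_preimage[OF pF D_open[OF i]] .
    have "?A \<subseteq> {c. p (c 1) \<in> U i}"
      using D_sub[OF i] by blast
    then have "continuous_map (subtopology ?F ?A) (XP r) (?z i)"
      using \<sigma>(2)[OF i] D_sub[OF i]
      by (intro continuous_fibre_coords e[OF i]) (auto intro: continuous_map_from_subtopology)
    from continuous_map_compose2[OF quotient_imp_continuous_map[OF quotient_map_orbit] this]
    have "continuous_map (subtopology ?F ?A) ?XPG (\<lambda>c. QR r (?z i c))"
      unfolding assoc_space_def .
    from openin_continuous_map_preimage[OF this V(1)[OF j]]
    have "openin (subtopology ?F ?A) (W j i)"
      by (rule back_subst[of "openin _"]) (auto simp: W_def)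
    then show ?thesis
      using A by (rule openin_trans_full)
  qed
  have W_section: "section_over (fibre_paths E p) ?F (eval_at r t) (W j i)"
    if i: "i \<le> k" and j: "j \<le> l" for j i
  proof (rule section_over_fibre_power[OF r V(2)[OF j] \<theta>(1), where e = "?e i"])
    have W_sub: "W j i \<subseteq> {c. p (c 1) \<in> U i}"
      using D_sub[OF i] by (auto simp: W_def)
    show "t m \<in> {0..1} \<and> \<theta> (t m) = s m" if "m \<in> {1..r}" for m
      using t(2) \<theta>(2) that by blast
    show e_cont: "continuous_map (subtopology ?F (W j i)) P (?e i)"
      using e[OF i W_sub] .
    fix c assume c: "c \<in> topspace ?F \<inter> W j i"
    then show pc: "p (c 1) = \<tau> (?e i c)"
      using \<sigma>(2)[OF i] W_sub by auto
    have "?e i c \<in> topspace P"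
      using e_cont c by (auto simp: continuous_map_def)
    from fibre_coords_in[of c r "?e i c", OF _ this pc] show "?z i c \<in> {z \<in> topspace (XP r). QR r z \<in> V j}"
      using c by (auto simp only: W_def)
  qed
  \<comment> \<open>The pairs \<open>(i, j)\<close> with \<open>i + j = n\<close>,
    \<open>i \<le> k\<close> and \<open>j \<le> l\<close>, indexed by \<open>i\<close>; the
    condition \<open>i \<le> n\<close> makes \<open>j = n - i\<close> a true difference.\<close>
  define I where "I = (\<lambda>n. {i. i \<le> k \<and> i \<le> n \<and> n - i \<le> l})"
  have disjoint: "disjoint_family_on (\<lambda>i. W (n - i) i) (I n)" for n
  proof -
    have "W (n - i) i \<inter> W (n - i') i' = {}" if "i \<in> I n" "i' \<in> I n" "i < i'" for i i'
    proof -
      have "Suc (n - i') \<le> n - i"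
        using that by (auto simp: I_def)
      then have "a (Suc (n - i')) \<le> a (n - i)"
        by (rule a_mono)
      then show ?thesis
        using that(3) by (fastforce simp: W_def D_def)
    qed
    then show ?thesis
      unfolding disjoint_family_on_def by (metis Int_commute linorder_neqE_nat)
  qed
  have "openin ?F (\<Union>i\<in>I n. W (n - i) i)" for n
    using W_open by (intro openin_Union) (auto simp: I_def)
  moreover have "section_over (fibre_paths E p) ?F (eval_at r t) (\<Union>i\<in>I n. W (n - i) i)" for n
    using W_open W_section disjoint by (intro section_over_disjoint_Union) (auto simp: I_def)
  moreover have "topspace ?F \<subseteq> (\<Union>n\<le>k + l. \<Union>i\<in>I n. W (n - i) i)"
  proof
    fix c assume c: "c \<in> topspace ?F"
    let ?b = "p (c 1)"
    have b: "?b \<in> topspace B"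
      using pF c by (auto simp: continuous_map_def)
    \<comment> \<open>The order of choices matters: \<open>D_cover\<close> needs \<open>j\<close>
      before it gives \<open>i\<close>. So \<open>j\<close> is found with an arbitrary
      \<open>e\<close> over the base point. The later change from \<open>e\<close> to
      \<open>?e i c\<close> is by a group element and preserves the orbit, hence membership in
      \<open>V j\<close>.\<close>
    then obtain e where e: "e \<in> topspace P" "\<tau> e = ?b"
      using local_coordinate_exists(2) by blast
    have z: "(fibre_coords r c e, e) \<in> topspace (XP r)"
      using fibre_coords_in[of c r e, OF c e(1)] e(2) by simp
    then obtain j where j: "j \<le> l" "QR r (fibre_coords r c e, e) \<in> V j"
      using V_cover by blast
    obtain i where i: "i \<le> k" "?b \<in> D j i"
      using D_cover[OF b j(1)] by blast
    then have bU: "?b \<in> U i"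
      using D_sub by blast
    then have "?e i c \<in> topspace P"
      using \<sigma>(1)[OF i(1)] b by (auto simp: continuous_map_def)
    then obtain g where g: "g \<in> carrier G" "\<psi> g e = ?e i c"
      using total_transitive[of e "?e i c"] e \<sigma>(2)[OF i(1) bU] by auto
    have "?z i c = diagonal_action (power_action r \<phi>) \<psi> g (fibre_coords r c e, e)"
      using fibre_coords_act[of c r e, OF c e(1) e(2)[symmetric] g(1)] g(2) by simp
    then have "QR r (?z i c) = QR r (fibre_coords r c e, e)"
      using orbit_acts[OF is_group acts_power_product z g(1)] by simp
    then have "c \<in> W j i"
      using c i j by (simp add: W_def)
    then have "c \<in> W (i + j - i) i" "i \<in> I (i + j)" "i + j \<le> k + l"
      using i(1) j(1) by (auto simp: I_def)
    then show "c \<in> (\<Union>n\<le>k + l. \<Union>i\<in>I n. W (n - i) i)"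
      by blast
  qed
  ultimately have "param_TC r t E p \<le> enat (k + l)"
    unfolding param_TC_def secat_def
    by (intro Inf_lower CollectI exI[of _ "k + l"] exI[of _ "\<lambda>n. \<Union>i\<in>I n. W (n - i) i"]
        conjI allI impI refl)
  then show ?thesis
    by (simp add: k l)
qed simp_all

end

theorem theorem8p1:
  fixes G :: "('g, 'm) monoid_scheme" and TG :: "'g topology"
    and X :: "'x topology" and \<phi> :: "'g \<Rightarrow> 'x \<Rightarrow> 'x"
    and P :: "'p topology" and \<psi> :: "'g \<Rightarrow> 'p \<Rightarrow> 'p"
    and B :: "'b topology" and \<tau> :: "'p \<Rightarrow> 'b"
    and E :: "('x \<times> 'p) set topology" and p :: "('x \<times> 'p) set \<Rightarrow> 'b"
    and r :: nat and t s :: "nat \<Rightarrow> real"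
  assumes "topological_group G TG"
    and "continuous_action G TG X \<phi>"
    and "principal_bundle G TG P \<psi> B \<tau>"
    and "E = assoc_space G X \<phi> P \<psi>"
    and "p = assoc_proj \<tau>"
    and "r \<ge> 2"
    and "strict_mono_on {1..r} t" and "t ` {1..r} \<subseteq> {0..1}"
    and "strict_mono_on {1..r} s" and "s 1 = 0" and "s r = 1"
  shows "weak_TC r s G X \<phi> P \<psi> \<le> param_TC r t E p \<and>
    (normal_space B \<longrightarrow>
       param_TC r t E p \<le> G_cat G TG X \<phi> P \<psi> B \<tau> + weak_TC r s G X \<phi> P \<psi>)"
proof -
  interpret associated_bundle G TG X \<phi> P \<psi> B \<tau>
    using assms(1-3) by unfold_locales
  have r: "1 \<le> r"
    using assms(6) by simp
  \<comment> \<open>The times \<open>s\<close> increase from 0 to 1, so the intermediate ones lie in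
    between.\<close>
  have "s i \<in> {0..1}" if "i \<in> {1..r}" for i
    using strict_mono_onD[OF assms(9), of 1 i] strict_mono_onD[OF assms(9), of i r]
      assms(10,11) that r by (cases "i = 1"; cases "i = r") auto
  then have s: "s ` {1..r} \<subseteq> {0..1}"
    by blast
  show ?thesis
    unfolding assms(4,5)
    using weak_TC_le_param_TC[OF r strict_mono_on_imp_inj_on[OF assms(9)] s assms(8)]
      param_TC_le[OF r strict_mono_on_imp_inj_on[OF assms(7)] assms(8) s]
    by blast
qed

end
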